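(* Let $1\le q<\infty$, and let $\psi$ be an increasing concave function on $[0,1]$ such that $\psi(0)=0$. Let $\Lambda_q(\psi)=\Lambda_q(\psi)[0,1]$ be the corresponding Lorentz space. Then $\mathcal F(\Lambda_q(\psi))=[1/\beta_{\psi,q},\,1/\alpha_{\psi,q}]$, where $$\alpha_{\psi,q}=-\lim_{n\to\infty}\frac1n\log_2\sup_{k\le0}\Big(\frac{\psi(2^{k-n})}{\psi(2^{k})}\Big)^{1/q},\qquad \beta_{\psi,q}=\lim_{n\to\infty}\frac1n\log_2\sup_{k\le0}\Big(\frac{\psi(2^{k})}{\psi(2^{k-n})}\Big)^{1/q},$$ the suprema being taken over integers $k\le 0$.
   Context: For measurable $x$ on $[0,1]$ let $x^*(t)=\inf\{\tau\ge0:m\{s:|x(s)|>\tau\}\le t\}$ be its right-continuous nonincreasing rearrangement ($m$ is Lebesgue measure). The Lorentz space $\Lambda_q(\psi)[0,1]$ consists of all measurable $x$ on $[0,1]$ with $$\|x\|_{\Lambda_q(\psi)}=\Big(\int_{[0,1]}x^*(t)^q\,d\psi(t)\Big)^{1/q}<\infty$$ (Stieltjes integral); its fundamental function is $\|\chi_A\|_{\Lambda_q(\psi)}=\psi(m(A))^{1/q}$ (so if $\psi$ had a jump at $0$, the corresponding mass at $0$ is included in the integral). Functions $x,y$ on $[0,1]$ are equimeasurable if $m\{|x|>\tau\}=m\{|y|>\tau\}$ for all $\tau>0$. For $a\in\mathbb R^n$, $\|a\|_p=(\sum_k|a_k|^p)^{1/p}$ if $1\le p<\infty$ and $\|a\|_\infty=\max_k|a_k|$.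 For $1\le p\le\infty$, $\ell^p$ is symmetrically finitely represented in a rearrangement invariant space $X$ on $[0,1]$ if for every $n\in\mathbb N$ and $\varepsilon>0$ there exist pairwise equimeasurable functions $x_1,\dots,x_n\in X$ with pairwise disjoint supports such that $(1+\varepsilon)^{-1}\|a\|_p\le\|\sum_{k=1}^na_kx_k\|_X\le(1+\varepsilon)\|a\|_p$ for all $a=(a_k)_{k=1}^n\in\mathbb R^n$. $\mathcal F(X)$ is the set of all $p\in[1,\infty]$ such that $\ell^p$ is symmetrically finitely represented in $X$. Convention: $1/0=\infty$, and intervals are subintervals of $[1,\infty]$ (so $\infty$ belongs to the interval when $\alpha_{\psi,q}=0$). *)

theory Defs
  imports "HOL-Analysis.Analysis"
begin

text \<open>
  Measurable functions on \<open>[0,1]\<close> are elements of \<open>borel_measurable (lebesgue_on {0..1})\<close>;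
  their values outside \<open>[0,1]\<close> are never looked at.
\<close>

definition distr_fun :: "(real \<Rightarrow> real) \<Rightarrow> real \<Rightarrow> real" where
  "distr_fun x \<tau> = measure (lebesgue_on {0..1}) {s \<in> {0..1}. \<bar>x s\<bar> > \<tau>}"

text \<open>
  The infimum is taken in the extended nonnegative reals, so that \<open>x\<^sup>*(0) = \<infinity>\<close> (infimum of
  the empty set) when \<open>x\<close> is essentially unbounded.
\<close>

definition rearrangement :: "(real \<Rightarrow> real) \<Rightarrow> real \<Rightarrow> ennreal" where
  "rearrangement x t = (INF \<tau> \<in> {\<tau>. 0 \<le> \<tau> \<and> distr_fun x \<tau> \<le> t}. ennreal \<tau>)"

definition equimeasurable :: "(real \<Rightarrow> real) \<Rightarrow> (real \<Rightarrow> real) \<Rightarrow> bool" where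
  "equimeasurable x y \<longleftrightarrow> (\<forall>\<tau>>0. distr_fun x \<tau> = distr_fun y \<tau>)"

text \<open>
  The Stieltjes measure \<open>d\<psi>\<close> on \<open>[0,1]\<close> of a nondecreasing \<open>\<psi>\<close>. The generating function is
  right-continuous, constant outside \<open>[0,1]\<close>, and jumps from \<open>\<psi>(0)\<close> to \<open>\<psi>(0+)\<close> at \<open>0\<close>, so that
  a jump of \<open>\<psi>\<close> at \<open>0\<close> gives the point \<open>0\<close> the mass \<open>\<psi>(0+) - \<psi>(0)\<close>.
\<close>

definition stieltjes_measure :: "(real \<Rightarrow> real) \<Rightarrow> real measure" where
  "stieltjes_measure \<psi> = interval_measure
     (\<lambda>t. if t < 0 then \<psi> 0 else if t < 1 then Lim (at_right t) \<psi> else \<psi> 1)"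

text \<open>Real powers on the extended nonnegative reals, for exponents \<open>r > 0\<close>.\<close>

definition ennreal_powr :: "ennreal \<Rightarrow> real \<Rightarrow> ennreal" where
  "ennreal_powr u r = (if u = \<infinity> then \<infinity> else ennreal (enn2real u powr r))"

definition lorentz_norm :: "real \<Rightarrow> (real \<Rightarrow> real) \<Rightarrow> (real \<Rightarrow> real) \<Rightarrow> ennreal" where
  "lorentz_norm q \<psi> x =
     ennreal_powr (\<integral>\<^sup>+t\<in>{0..1}. ennreal_powr (rearrangement x t) q \<partial>stieltjes_measure \<psi>) (1 / q)"

definition lorentz_space :: "real \<Rightarrow> (real \<Rightarrow> real) \<Rightarrow> (real \<Rightarrow> real) set" where
  "lorentz_space q \<psi> = {x \<in> borel_measurable (lebesgue_on {0..1}). lorentz_norm q \<psi> x < \<infinity>}"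

text \<open>The norm of \<open>\<ell>\<^sup>p\<^sub>n\<close>, for \<open>1 \<le> p \<le> \<infinity>\<close> and \<open>n \<ge> 1\<close>; a vector is given by its entries at \<open>k < n\<close>.\<close>

definition lp_norm :: "ereal \<Rightarrow> nat \<Rightarrow> (nat \<Rightarrow> real) \<Rightarrow> real" where
  "lp_norm p n a =
     (if p = \<infinity> then Max ((\<lambda>k. \<bar>a k\<bar>) ` {..<n})
      else (\<Sum>k<n. \<bar>a k\<bar> powr real_of_ereal p) powr (1 / real_of_ereal p))"

text \<open>A function space on \<open>[0,1]\<close> is given by its set \<open>X\<close> of elements and its norm \<open>N\<close> on \<open>X\<close>.\<close>

definition symm_finitely_represented ::
  "ereal \<Rightarrow> (real \<Rightarrow> real) set \<Rightarrow> ((real \<Rightarrow> real) \<Rightarrow> real) \<Rightarrow> bool" where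
  "symm_finitely_represented p X N \<longleftrightarrow>
     (\<forall>n\<ge>1. \<forall>\<epsilon>>0. \<exists>x :: nat \<Rightarrow> real \<Rightarrow> real.
        (\<forall>k<n. x k \<in> X) \<and>
        (\<forall>i<n. \<forall>j<n. equimeasurable (x i) (x j)) \<and>
        disjoint_family_on (\<lambda>k. {t \<in> {0..1}. x k t \<noteq> 0}) {..<n} \<and>
        (\<forall>a :: nat \<Rightarrow> real.
           lp_norm p n a / (1 + \<epsilon>) \<le> N (\<lambda>t. \<Sum>k<n. a k * x k t) \<and>
           N (\<lambda>t. \<Sum>k<n. a k * x k t) \<le> (1 + \<epsilon>) * lp_norm p n a))"

definition fin_rep_set :: "(real \<Rightarrow> real) set \<Rightarrow> ((real \<Rightarrow> real) \<Rightarrow> real) \<Rightarrow> ereal set" where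
  "fin_rep_set X N = {p. 1 \<le> p \<and> symm_finitely_represented p X N}"

definition alpha_index :: "real \<Rightarrow> (real \<Rightarrow> real) \<Rightarrow> real" where
  "alpha_index q \<psi> =
     - lim (\<lambda>n::nat. 1 / real n *
         log 2 (SUP k\<in>{..0::int}. (\<psi> (2 powi (k - int n)) / \<psi> (2 powi k)) powr (1 / q)))"

definition beta_index :: "real \<Rightarrow> (real \<Rightarrow> real) \<Rightarrow> real" where
  "beta_index q \<psi> =
     lim (\<lambda>n::nat. 1 / real n *
         log 2 (SUP k\<in>{..0::int}. (\<psi> (2 powi k) / \<psi> (2 powi (k - int n))) powr (1 / q)))"

end

theory Submission
  imports Defs
begin

text \<open>
  The layer-cake formula turns the norm of the Lorentz space into an integral that only sees the
  distribution function \<open>d\<close> of \<open>x\<close>: the \<open>q\<close>-th power of the norm is the integral of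
  \<open>\<psi> (d (s powr (1/q)))\<close> over \<open>s > 0\<close> (\<open>lorentz_norm_eq_modular\<close>). If \<open>x\<^sub>1, \<dots>, x\<^sub>n\<close> are disjointly
  supported with common distribution function \<open>d\<close>, then the combination with coefficients \<open>a\<^sub>k\<close>
  has the distribution function \<open>\<tau> \<mapsto> \<Sum>k. d (\<tau> / \<bar>a\<^sub>k\<bar>)\<close>. The whole question is therefore about one
  nonincreasing function \<open>d\<close>.

  The indices are necessary bounds: for \<open>n = 2 ^ m\<close> and equal coefficients the passage from one
  function to the sum multiplies \<open>d\<close> by \<open>2 ^ m\<close>. This changes \<open>\<psi> (d)\<close> by a factor between the
  extremal dyadic ratios of \<open>\<psi>\<close> at distance \<open>m\<close>, and the norm by about \<open>2 powr (m/p)\<close>. Letting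
  \<open>m\<close> grow compares \<open>1/p\<close> with both indices (\<open>represented_imp_between_indices\<close>).

  The bounds are sufficient: for \<open>d(\<tau>) = \<tau> powr -p\<close> one has
  \<open>\<Sum>k. d (\<tau> / \<bar>a\<^sub>k\<bar>) = (\<Sum>k. \<bar>a\<^sub>k\<bar> powr p) * d(\<tau>)\<close>, which is exact \<open>\<ell>\<^sup>p\<close> behaviour. So the functions are
  disjoint translates of \<open>t powr (-1/p)\<close>, which has to be truncated to a window
  \<open>2 powr -j \<le> t \<le> 2 powr -i\<close>. The truncation spoils the identity only near the two ends of the window.
  With \<open>W l = 2 powr (l * q/p) * \<psi> (2 powr -l)\<close> the ends contribute at most a constant times \<open>W i + W j\<close> and
  the whole window at least a constant times the sum of the \<open>W l\<close>, \<open>i < l \<le> j\<close>. It remains to find windows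
  with negligible ends. If every window beyond some point had heavy ends, then \<open>W\<close> would eventually
  grow geometrically or eventually decay geometrically (\<open>window_or_geometric\<close>); the
  first forces \<open>\<beta> < 1/p\<close> and the second \<open>1/p < \<alpha>\<close> (\<open>window_exists\<close>). For \<open>p = \<infinity>\<close> the same role is played
  by indicator functions of intervals of a length \<open>t\<close> at which \<open>\<psi>\<close> is flat, \<open>\<psi> (n t) \<le> (1 + \<epsilon>) \<psi> t\<close>;
  such \<open>t\<close> exist because \<open>\<alpha> = 0\<close>.
\<close>

section \<open>Concave weights and their Stieltjes measures\<close>

locale concave_weight =
  fixes \<psi> :: "real \<Rightarrow> real"
  assumes mono_weight: "mono_on {0..1} \<psi>"
    and concave_weight: "concave_on {0..1} \<psi>"
    and weight_0 [simp]: "\<psi> 0 = 0"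
    and weight_nontrivial: "\<exists>t\<in>{0..1}. \<psi> t \<noteq> 0"
begin

lemma weight_mono: "0 \<le> s \<Longrightarrow> s \<le> t \<Longrightarrow> t \<le> 1 \<Longrightarrow> \<psi> s \<le> \<psi> t"
  using mono_weight by (auto simp: mono_on_def)

lemma weight_nonneg: "0 \<le> t \<Longrightarrow> t \<le> 1 \<Longrightarrow> 0 \<le> \<psi> t"
  using weight_mono[of 0 t] by simp

lemma weight_scale_down:
  assumes "0 \<le> c" "c \<le> 1" "0 \<le> t" "t \<le> 1"
  shows "c * \<psi> t \<le> \<psi> (c * t)"
proof -
  have cv: "convex_on {0..1} (\<lambda>x. - \<psi> x)"
    using concave_weight by (simp add: concave_on_def)
  have "- \<psi> ((1 - c) *\<^sub>R 0 + c *\<^sub>R t) \<le> (1 - c) * (- \<psi> 0) + c * (- \<psi> t)"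
    by (rule convex_onD[OF cv]) (use assms in auto)
  then show ?thesis by simp
qed

lemma weight_scale_up:
  assumes "1 \<le> c" "0 \<le> t" "c * t \<le> 1"
  shows "\<psi> (c * t) \<le> c * \<psi> t"
proof -
  have "(1 / c) * \<psi> (c * t) \<le> \<psi> ((1 / c) * (c * t))"
    by (rule weight_scale_down) (use assms in auto)
  with assms show ?thesis by (simp add: field_simps)
qed

lemma weight_pos:
  assumes "0 < t" "t \<le> 1"
  shows "0 < \<psi> t"
proof -
  obtain u where u: "u \<in> {0..1}" "\<psi> u \<noteq> 0" using weight_nontrivial by blast
  then have u0: "0 < u" by (cases "u = 0") auto
  have "\<psi> u > 0" using u weight_nonneg[of u] by auto
  show ?thesis
  proof (cases "u \<le> t")
    case True
    with u u0 assms weight_mono[of u t] \<open>\<psi> u > 0\<close> show ?thesis by auto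
  next
    case False
    have "(t / u) * \<psi> u \<le> \<psi> ((t / u) * u)"
      by (rule weight_scale_down) (use False u u0 assms in auto)
    moreover have "(t / u) * \<psi> u > 0" using \<open>\<psi> u > 0\<close> u0 assms by simp
    ultimately show ?thesis using u0 by simp
  qed
qed

lemma weight_compare:
  assumes "0 < s" "s \<le> t" "t \<le> 1"
  shows "\<psi> t \<le> (t / s) * \<psi> s"
  using weight_scale_up[of "t / s" s] assms by simp

text \<open>
  The weight \<open>\<psi>\<close> increases while \<open>\<psi> t / t\<close> decreases. So \<open>\<psi> s\<close> lies between \<open>\<psi> t\<close> and
  \<open>(s / t) * \<psi> t\<close>, which squeezes it to \<open>\<psi> t\<close> as \<open>s\<close> tends to \<open>t\<close>.
\<close>

lemma weight_tendsto:
  assumes "0 < t" "t < 1"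
  shows "(\<psi> \<longlongrightarrow> \<psi> t) (at t)"
proof (rule tendsto_sandwich)
  have ev: "\<forall>\<^sub>F s in at t. 0 < s \<and> s < 1"
    using assms by (intro eventually_conj order_tendstoD[OF tendsto_ident_at])
  have *: "min 1 (s / t) * \<psi> t \<le> \<psi> s \<and> \<psi> s \<le> max 1 (s / t) * \<psi> t" if "0 < s" "s < 1" for s
  proof (cases "s \<le> t")
    case True
    then show ?thesis
      using weight_compare[of s t] weight_mono[of s t] that assms
      by (auto simp: min_def max_def field_simps)
  next
    case False
    then show ?thesis
      using weight_compare[of t s] weight_mono[of t s] that assms
      by (auto simp: min_def max_def field_simps)
  qed
  show "\<forall>\<^sub>F s in at t. min 1 (s / t) * \<psi> t \<le> \<psi> s"
    using ev by eventually_elim (use * in blast)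
  show "\<forall>\<^sub>F s in at t. \<psi> s \<le> max 1 (s / t) * \<psi> t"
    using ev by eventually_elim (use * in blast)
  show "((\<lambda>s. min 1 (s / t) * \<psi> t) \<longlongrightarrow> \<psi> t) (at t)"
    by (rule tendsto_eq_intros refl | use assms in simp)+
  show "((\<lambda>s. max 1 (s / t) * \<psi> t) \<longlongrightarrow> \<psi> t) (at t)"
    by (rule tendsto_eq_intros refl | use assms in simp)+
qed

lemma weight_tendsto_left:
  assumes "0 < t" "t \<le> 1"
  shows "(\<psi> \<longlongrightarrow> \<psi> t) (at_left t)"
proof (rule tendsto_sandwich)
  have ev: "\<forall>\<^sub>F s in at_left t. 0 < s \<and> s < t"
    using assms by (auto simp: eventually_at_left_field)
  show "\<forall>\<^sub>F s in at_left t. (s / t) * \<psi> t \<le> \<psi> s"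
    using ev
  proof eventually_elim
    case (elim s)
    with weight_compare[of s t] assms show ?case by (auto simp: field_simps)
  qed
  show "\<forall>\<^sub>F s in at_left t. \<psi> s \<le> \<psi> t"
    using ev by eventually_elim (use weight_mono assms in auto)
  show "((\<lambda>s. (s / t) * \<psi> t) \<longlongrightarrow> \<psi> t) (at_left t)"
    by (rule tendsto_eq_intros refl | use assms in simp)+
qed auto

definition weight_0_plus :: real where "weight_0_plus = (INF t\<in>{0<..<1}. \<psi> t)"

lemma weight_0_plus_le: "0 < t \<Longrightarrow> t \<le> 1 \<Longrightarrow> weight_0_plus \<le> \<psi> t"
proof -
  assume t: "0 < t" "t \<le> 1"
  have "weight_0_plus \<le> \<psi> (t / 2)"
    unfolding weight_0_plus_def
    by (rule cINF_lower) (use t in \<open>auto intro!: bdd_belowI2[of _ 0] weight_nonneg\<close>)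
  also have "\<dots> \<le> \<psi> t" using t by (intro weight_mono) auto
  finally show ?thesis .
qed

lemma weight_0_plus_nonneg: "0 \<le> weight_0_plus"
  unfolding weight_0_plus_def by (rule cINF_greatest) (auto intro: weight_nonneg)

lemma weight_tendsto_0: "(\<psi> \<longlongrightarrow> weight_0_plus) (at_right 0)"
proof (rule order_tendstoI)
  fix a assume "a < weight_0_plus"
  moreover have "\<forall>\<^sub>F s in at_right (0::real). 0 < s \<and> s < 1"
    by (auto simp: eventually_at_right_field intro: exI[of _ 1])
  ultimately show "\<forall>\<^sub>F s in at_right 0. a < \<psi> s"
    by (elim eventually_mono) (use weight_0_plus_le in force)
next
  fix a assume "weight_0_plus < a"
  then obtain t where t: "t \<in> {0<..<1}" "\<psi> t < a"
    unfolding weight_0_plus_def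
    by (subst (asm) cINF_less_iff) (auto intro!: bdd_belowI2[of _ 0] weight_nonneg)
  have "\<forall>\<^sub>F s in at_right (0::real). 0 < s \<and> s < t"
    using t by (auto simp: eventually_at_right_field intro: exI[of _ t])
  then show "\<forall>\<^sub>F s in at_right 0. \<psi> s < a"
  proof eventually_elim
    case (elim s)
    with t weight_mono[of s t] show ?case by auto
  qed
qed

text \<open>
  The generating function of the Stieltjes measure with its right limits evaluated. Only the limit
  at \<open>0\<close> can differ from the value of \<open>\<psi>\<close>.
\<close>

definition stieltjes_fun :: "real \<Rightarrow> real" where
  "stieltjes_fun t = (if t < 0 then 0 else if t = 0 then weight_0_plus else \<psi> (min t 1))"

lemma stieltjes_fun_eq:
  "(\<lambda>t. if t < 0 then \<psi> 0 else if t < 1 then Lim (at_right t) \<psi> else \<psi> 1) = stieltjes_fun"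
proof
  fix t :: real
  have "Lim (at_right t) \<psi> = \<psi> t" if "0 < t" "t < 1"
    using weight_tendsto[OF that] by (intro tendsto_Lim) (auto simp: filterlim_at_split)
  moreover have "Lim (at_right 0) \<psi> = weight_0_plus"
    using weight_tendsto_0 by (intro tendsto_Lim) auto
  ultimately show "(if t < 0 then \<psi> 0 else if t < 1 then Lim (at_right t) \<psi> else \<psi> 1) = stieltjes_fun t"
    by (auto simp: stieltjes_fun_def min_def)
qed

lemma stieltjes_fun_mono: "x \<le> y \<Longrightarrow> stieltjes_fun x \<le> stieltjes_fun y"
  by (auto simp: stieltjes_fun_def min_def weight_0_plus_nonneg
      intro!: weight_mono weight_nonneg weight_0_plus_le)

lemma stieltjes_fun_right_cont: "continuous (at_right a) stieltjes_fun"
proof -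
  consider "a < 0" | "a = 0" | "0 < a" "a < 1" | "1 \<le> a" by linarith
  then have "(stieltjes_fun \<longlongrightarrow> stieltjes_fun a) (at_right a)"
  proof cases
    case 1
    have "\<forall>\<^sub>F s in at_right a. s < 0" using 1 by (auto simp: eventually_at_right_field)
    then have "\<forall>\<^sub>F s in at_right a. stieltjes_fun s = stieltjes_fun a"
      by (rule eventually_mono) (use 1 in \<open>simp add: stieltjes_fun_def\<close>)
    then show ?thesis by (rule tendsto_eventually)
  next
    case 2
    have "\<forall>\<^sub>F s in at_right (0::real). 0 < s \<and> s < 1"
      by (auto simp: eventually_at_right_field intro: exI[of _ 1])
    then have "\<forall>\<^sub>F s in at_right a. \<psi> s = stieltjes_fun s"
      unfolding 2 by (rule eventually_mono) (simp add: stieltjes_fun_def)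
    moreover have "(\<psi> \<longlongrightarrow> stieltjes_fun a) (at_right a)"
      using weight_tendsto_0 2 by (simp add: stieltjes_fun_def)
    ultimately show ?thesis by (rule Lim_transform_eventually[rotated])
  next
    case 3
    have "\<forall>\<^sub>F s in at_right a. a < s \<and> s < 1"
      using 3 by (auto simp: eventually_at_right_field)
    then have "\<forall>\<^sub>F s in at_right a. \<psi> s = stieltjes_fun s"
      by (rule eventually_mono) (use 3 in \<open>simp add: stieltjes_fun_def\<close>)
    moreover have "(\<psi> \<longlongrightarrow> stieltjes_fun a) (at_right a)"
      using weight_tendsto[OF 3] 3 by (simp add: stieltjes_fun_def filterlim_at_split)
    ultimately show ?thesis by (rule Lim_transform_eventually[rotated])
  next
    case 4
    have "\<forall>\<^sub>F s in at_right a. a < s" by (auto simp: eventually_at_right_field intro: exI[of _ "a+1"])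
    then have "\<forall>\<^sub>F s in at_right a. stieltjes_fun s = stieltjes_fun a"
      by (rule eventually_mono) (use 4 in \<open>simp add: stieltjes_fun_def\<close>)
    then show ?thesis by (rule tendsto_eventually)
  qed
  then show ?thesis by (simp add: continuous_within)
qed

lemma stieltjes_measure_eq: "stieltjes_measure \<psi> = interval_measure stieltjes_fun"
  unfolding stieltjes_measure_def stieltjes_fun_eq ..

lemma sets_stieltjes [simp, measurable_cong]: "sets (stieltjes_measure \<psi>) = sets borel"
  by (simp add: stieltjes_measure_eq)

lemma sigma_finite_stieltjes: "sigma_finite_measure (stieltjes_measure \<psi>)"
  unfolding stieltjes_measure_eq
  by (rule sigma_finite_interval_measure) (auto intro: stieltjes_fun_mono stieltjes_fun_right_cont)

lemma emeasure_stieltjes_Ioc: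
  "a \<le> b \<Longrightarrow> emeasure (stieltjes_measure \<psi>) {a<..b} = ennreal (stieltjes_fun b - stieltjes_fun a)"
  unfolding stieltjes_measure_eq
  by (rule emeasure_interval_measure_Ioc) (auto intro: stieltjes_fun_mono stieltjes_fun_right_cont)

text \<open>
  Half-open intervals are the generators of an interval measure; open ones are exhausted from the
  left by a sequence along which the limit of the generating function is known.
\<close>

lemma emeasure_stieltjes_Iio:
  assumes "a < b" "\<And>n. f n < b" "\<And>n. a \<le> f n" "incseq f" "f \<longlonglongrightarrow> b" "(\<lambda>n. stieltjes_fun (f n)) \<longlonglongrightarrow> L"
  shows "emeasure (stieltjes_measure \<psi>) {a<..<b} = ennreal (L - stieltjes_fun a)"
proof (rule LIMSEQ_unique)
  have "(\<Union>n. {a<..f n}) = {a<..<b}"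
  proof (intro equalityI subsetI)
    fix x assume "x \<in> {a<..<b}"
    then have "\<forall>\<^sub>F n in sequentially. x < f n" using assms(5) by (auto dest: order_tendstoD(1))
    then obtain n where "x < f n" by (auto simp: eventually_sequentially)
    with \<open>x \<in> {a<..<b}\<close> show "x \<in> (\<Union>n. {a<..f n})" by (auto intro: less_imp_le)
  qed (use assms(2) in \<open>auto intro: le_less_trans\<close>)
  moreover have "(\<lambda>n. emeasure (stieltjes_measure \<psi>) {a<..f n}) \<longlonglongrightarrow> emeasure (stieltjes_measure \<psi>) (\<Union>n. {a<..f n})"
  proof (rule Lim_emeasure_incseq)
    show "incseq (\<lambda>n. {a<..f n})"
    proof (rule incseq_SucI)
      fix n
      have "f n \<le> f (Suc n)" by (rule incseq_SucD[OF assms(4)])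
      then show "{a<..f n} \<subseteq> {a<..f (Suc n)}" by auto
    qed
  qed auto
  ultimately show "(\<lambda>n. emeasure (stieltjes_measure \<psi>) {a<..f n}) \<longlonglongrightarrow> emeasure (stieltjes_measure \<psi>) {a<..<b}"
    by simp
  show "(\<lambda>n. emeasure (stieltjes_measure \<psi>) {a<..f n}) \<longlonglongrightarrow> ennreal (L - stieltjes_fun a)"
    using assms by (subst emeasure_stieltjes_Ioc) (auto intro!: tendsto_intros)
qed

text \<open>
  A jump of \<open>\<psi>\<close> at \<open>0\<close> is a point mass at \<open>0\<close>, which belongs to \<open>[0,d)\<close> as soon as \<open>d > 0\<close>; left
  continuity of \<open>\<psi>\<close> at \<open>d\<close> deals with the other end. The super-level sets of a rearrangement have
  exactly this form.
\<close>

lemma emeasure_stieltjes_initial: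
  assumes "0 \<le> d" "d \<le> 1"
  shows "emeasure (stieltjes_measure \<psi>) {0..<d} = ennreal (\<psi> d)"
proof (cases "d = 0")
  case False
  with assms have d: "0 < d" by simp
  \<comment> \<open>The measure is defined through half-open intervals, so the null set left of 0 is added and removed.\<close>
  have null: "emeasure (stieltjes_measure \<psi>) {-1<..<0} = ennreal (0 - stieltjes_fun (-1))"
  proof (rule emeasure_stieltjes_Iio)
    show "incseq (\<lambda>n. - 1 / real (Suc n))" by (auto simp: incseq_def field_simps)
    show "(\<lambda>n. - 1 / real (Suc n)) \<longlonglongrightarrow> 0"
      using tendsto_minus[OF LIMSEQ_inverse_real_of_nat] by (simp add: field_simps)
  qed (auto simp: stieltjes_fun_def field_simps)
  let ?f = "\<lambda>n. d * (1 - 1 / real (Suc (Suc n)))"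
  have lim: "?f \<longlonglongrightarrow> d"
    using tendsto_mult[OF tendsto_const tendsto_diff[OF tendsto_const LIMSEQ_Suc[OF LIMSEQ_inverse_real_of_nat]], of d 1]
    by (simp add: field_simps)
  have f: "0 < ?f n" "?f n < d" for n using d by (auto simp: divide_less_eq)
  have "filterlim ?f (at_left d) sequentially"
    using lim f by (auto simp: filterlim_at intro!: always_eventually)
  then have "(\<lambda>n. \<psi> (?f n)) \<longlonglongrightarrow> \<psi> d"
    by (rule filterlim_compose[OF weight_tendsto_left[OF d assms(2)]])
  moreover have "stieltjes_fun (?f n) = \<psi> (?f n)" for n
    using f[of n] assms unfolding stieltjes_fun_def by auto
  ultimately have lim2: "(\<lambda>n. stieltjes_fun (?f n)) \<longlonglongrightarrow> \<psi> d" by simp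
  have "emeasure (stieltjes_measure \<psi>) {-1<..<d} = ennreal (\<psi> d - stieltjes_fun (-1))"
  proof (rule emeasure_stieltjes_Iio[OF _ _ _ _ lim lim2])
    show "incseq ?f" using d by (intro incseq_SucI) (auto simp: field_simps)
    show "- 1 \<le> ?f n" for n using f[of n] by simp
  qed (use d f in auto)
  moreover have "{-1<..<d} = {-1<..<0} \<union> {0..<d}" using d by auto
  moreover have "emeasure (stieltjes_measure \<psi>) ({-1<..<0} \<union> {0..<d}) =
      emeasure (stieltjes_measure \<psi>) {-1<..<0} + emeasure (stieltjes_measure \<psi>) {0..<d}"
    by (intro plus_emeasure[symmetric]) auto
  ultimately show ?thesis using null by (simp add: stieltjes_fun_def)
qed simp

end

section \<open>Distribution functions and the layer-cake formula\<close>

lemma finite_measure_unit_interval: "finite_measure (lebesgue_on {0..1::real})"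
  by (rule finite_measureI) (simp add: emeasure_restrict_space)

lemma level_set_sets:
  fixes x :: "real \<Rightarrow> real"
  assumes "x \<in> borel_measurable (lebesgue_on {0..1})"
  shows "{s \<in> {0..1}. \<bar>x s\<bar> > \<tau>} \<in> sets (lebesgue_on {0..1})"
proof -
  have "{s \<in> space (lebesgue_on {0..1}). \<tau> < \<bar>x s\<bar>} \<in> sets (lebesgue_on {0..1})"
    using borel_measurable_abs[OF assms] by (simp add: borel_measurable_iff_greater)
  then show ?thesis by simp
qed

lemma distr_fun_nonneg: "0 \<le> distr_fun x \<tau>"
  by (simp add: distr_fun_def)

lemma distr_fun_le_1: "distr_fun x \<tau> \<le> 1"
proof -
  interpret finite_measure "lebesgue_on {0..1::real}" by (rule finite_measure_unit_interval)
  have "distr_fun x \<tau> \<le> measure (lebesgue_on {0..1::real}) (space (lebesgue_on {0..1}))"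
    unfolding distr_fun_def by (rule bounded_measure)
  then show ?thesis by (simp add: measure_restrict_space)
qed

lemma distr_fun_antimono:
  assumes "x \<in> borel_measurable (lebesgue_on {0..1})" "\<sigma> \<le> \<tau>"
  shows "distr_fun x \<tau> \<le> distr_fun x \<sigma>"
  unfolding distr_fun_def
  by (rule finite_measure.finite_measure_mono[OF finite_measure_unit_interval])
    (use assms level_set_sets in auto)

text \<open>
  Right continuity of the distribution function, in the only form needed: strict lower bounds
  persist slightly to the right.
\<close>

lemma distr_fun_right_limit:
  assumes "x \<in> borel_measurable (lebesgue_on {0..1})" "t < distr_fun x \<sigma>"
  obtains \<tau> where "\<sigma> < \<tau>" "t < distr_fun x \<tau>"
proof -
  interpret finite_measure "lebesgue_on {0..1::real}" by (rule finite_measure_unit_interval)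
  let ?A = "\<lambda>n. {s \<in> {0..1}. \<bar>x s\<bar> > \<sigma> + 1 / real (Suc n)}"
  have Un: "(\<Union>n. ?A n) = {s \<in> {0..1}. \<bar>x s\<bar> > \<sigma>}"
  proof (intro equalityI subsetI)
    fix s assume s: "s \<in> {s \<in> {0..1}. \<bar>x s\<bar> > \<sigma>}"
    then obtain n where "1 / real (Suc n) < \<bar>x s\<bar> - \<sigma>"
      using reals_Archimedean[of "\<bar>x s\<bar> - \<sigma>"] by (auto simp: inverse_eq_divide)
    with s show "s \<in> (\<Union>n. ?A n)" by (auto intro!: exI[of _ n])
  next
    fix s assume "s \<in> (\<Union>n. ?A n)"
    then obtain n where "s \<in> {0..1}" "\<bar>x s\<bar> > \<sigma> + 1 / real (Suc n)" by auto
    moreover have "0 < 1 / real (Suc n)" by simp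
    ultimately have "\<bar>x s\<bar> > \<sigma>" by linarith
    with \<open>s \<in> {0..1}\<close> show "s \<in> {s \<in> {0..1}. \<bar>x s\<bar> > \<sigma>}" by simp
  qed
  have "(\<lambda>n. measure (lebesgue_on {0..1}) (?A n)) \<longlonglongrightarrow> measure (lebesgue_on {0..1}) (\<Union>n. ?A n)"
  proof (rule finite_Lim_measure_incseq)
    show "incseq ?A"
    proof (rule incseq_SucI, safe)
      fix n s assume "\<bar>x s\<bar> > \<sigma> + 1 / real (Suc n)"
      moreover have "1 / real (Suc (Suc n)) \<le> 1 / real (Suc n)" by (simp add: field_simps)
      ultimately show "\<bar>x s\<bar> > \<sigma> + 1 / real (Suc (Suc n))" by linarith
    qed
  qed (use level_set_sets[OF assms(1)] in auto)
  then have "(\<lambda>n. distr_fun x (\<sigma> + 1 / real (Suc n))) \<longlonglongrightarrow> distr_fun x \<sigma>"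
    unfolding Un distr_fun_def .
  from order_tendstoD(1)[OF this assms(2)] obtain n where "t < distr_fun x (\<sigma> + 1 / real (Suc n))"
    by (auto simp: eventually_sequentially)
  then show ?thesis by (intro that[of "\<sigma> + 1 / real (Suc n)"]) auto
qed

text \<open>
  The rearrangement is the generalised inverse of the distribution function; right continuity makes
  the strict inequalities correspond without exceptional values.
\<close>

lemma less_rearrangement_iff:
  assumes x: "x \<in> borel_measurable (lebesgue_on {0..1})" and "0 \<le> \<sigma>"
  shows "ennreal \<sigma> < rearrangement x t \<longleftrightarrow> t < distr_fun x \<sigma>"
proof
  assume *: "ennreal \<sigma> < rearrangement x t"
  show "t < distr_fun x \<sigma>"
  proof (rule ccontr)
    assume "\<not> t < distr_fun x \<sigma>"
    then have "rearrangement x t \<le> ennreal \<sigma>"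
      unfolding rearrangement_def using \<open>0 \<le> \<sigma>\<close> by (intro INF_lower) auto
    with * show False by simp
  qed
next
  assume "t < distr_fun x \<sigma>"
  then obtain \<tau> where \<tau>: "\<sigma> < \<tau>" "t < distr_fun x \<tau>" using distr_fun_right_limit[OF x] by blast
  have "ennreal \<tau> \<le> rearrangement x t"
    unfolding rearrangement_def
  proof (rule INF_greatest)
    fix r assume "r \<in> {r. 0 \<le> r \<and> distr_fun x r \<le> t}"
    then have "\<not> r \<le> \<tau>" using distr_fun_antimono[OF x, of r \<tau>] \<tau> by auto
    then show "ennreal \<tau> \<le> ennreal r" by (intro ennreal_leI) simp
  qed
  moreover have "ennreal \<sigma> < ennreal \<tau>" using \<tau> \<open>0 \<le> \<sigma>\<close> by (simp add: ennreal_less_iff)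
  ultimately show "ennreal \<sigma> < rearrangement x t" by simp
qed

lemma less_ennreal_powr_iff:
  assumes "0 < q" "0 \<le> s"
  shows "ennreal s < ennreal_powr u q \<longleftrightarrow> ennreal (s powr (1 / q)) < u"
proof (cases u)
  case (real v)
  have "s < v powr q \<longleftrightarrow> s powr (1 / q) < v"
  proof
    assume "s < v powr q"
    then have "s powr (1 / q) < (v powr q) powr (1 / q)" using assms by (intro powr_less_mono2) auto
    then show "s powr (1 / q) < v" using assms real by (simp add: powr_powr)
  next
    assume "s powr (1 / q) < v"
    then have "(s powr (1 / q)) powr q < v powr q" using assms by (intro powr_less_mono2) auto
    then show "s < v powr q" using assms by (simp add: powr_powr)
  qed
  with real assms show ?thesis by (simp add: ennreal_powr_def ennreal_less_iff)
qed (simp add: ennreal_powr_def)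

lemma ennreal_eq_emeasure_below: "emeasure lborel {s::real. 0 < s \<and> ennreal s < u} = u"
proof (cases u)
  case (real v)
  then have "{s::real. 0 < s \<and> ennreal s < u} = {0<..<v}" by (auto simp: ennreal_less_iff)
  with real show ?thesis by simp
next
  case top
  have "emeasure lborel {0<..<real n} \<le> emeasure lborel {0::real<..}" for n
    by (intro emeasure_mono) auto
  then have "\<And>n. of_nat n \<le> emeasure lborel {0::real<..}" by (simp add: ennreal_of_nat_eq_real_of_nat)
  then have "emeasure lborel {0::real<..} = top"
    by (metis ennreal_Ex_less_of_nat leD top.not_eq_extremum infinity_ennreal_def)
  moreover have "{s::real. 0 < s \<and> ennreal s < u} = {0<..}" using top by auto
  ultimately show ?thesis using top by simp
qed

text \<open>
  The layer-cake expression for the \<open>q\<close>-th power of the Lorentz norm. The level \<open>s = 0\<close> is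
  excluded, since equimeasurability says nothing about it.
\<close>

definition lorentz_modular :: "real \<Rightarrow> (real \<Rightarrow> real) \<Rightarrow> (real \<Rightarrow> real) \<Rightarrow> ennreal" where
  "lorentz_modular q \<psi> x = (\<integral>\<^sup>+s\<in>{0<..}. ennreal (\<psi> (distr_fun x (s powr (1 / q)))) \<partial>lborel)"

context concave_weight
begin

text \<open>
  Write \<open>x\<^sup>*(t)\<^sup>q\<close> as the length of the set of levels \<open>s\<close> below it and exchange the integrations; for
  fixed \<open>s\<close> the condition on \<open>t\<close> says that \<open>t\<close> lies in \<open>[0, d (s powr (1/q)))\<close>, an interval of
  Stieltjes mass \<open>\<psi> (d (s powr (1/q)))\<close>.
\<close>

lemma lorentz_norm_eq_modular:
  assumes q: "0 < q" and x: "x \<in> borel_measurable (lebesgue_on {0..1})"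
  shows "lorentz_norm q \<psi> x = ennreal_powr (lorentz_modular q \<psi> x) (1 / q)"
proof -
  let ?\<nu> = "stieltjes_measure \<psi>"
  let ?F = "\<lambda>t. ennreal_powr (rearrangement x t) q"
  interpret pair_sigma_finite lborel ?\<nu>
    by (intro pair_sigma_finite.intro sigma_finite_stieltjes sigma_finite_lborel)
  have iff: "ennreal s < ?F t \<longleftrightarrow> t < distr_fun x (s powr (1 / q))" if "0 \<le> s" for s t
    using less_ennreal_powr_iff[OF q that] less_rearrangement_iff[OF x, of "s powr (1/q)"] by simp
  have [measurable]: "?F \<in> borel_measurable borel"
  proof (rule borel_measurableI_greater)
    fix a :: ennreal
    show "{w \<in> space borel. a < ?F w} \<in> sets borel"
    proof (cases a)
      case (real s)
      then have "{w \<in> space borel. a < ?F w} = {..<distr_fun x (s powr (1 / q))}"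
        using iff by auto
      then show ?thesis by simp
    qed simp
  qed
  have "(\<integral>\<^sup>+t\<in>{0..1}. ?F t \<partial>?\<nu>) =
      (\<integral>\<^sup>+t. (\<integral>\<^sup>+s. indicator {s. 0 < s \<and> ennreal s < ?F t} s * indicator {0..1} t \<partial>lborel) \<partial>?\<nu>)"
    by (intro nn_integral_cong)
      (simp add: nn_integral_multc ennreal_eq_emeasure_below)
  also have "\<dots> = (\<integral>\<^sup>+s. (\<integral>\<^sup>+t. indicator {s. 0 < s \<and> ennreal s < ?F t} s * indicator {0..1} t \<partial>?\<nu>) \<partial>lborel)"
    by (rule Fubini') measurable
  also have "\<dots> = lorentz_modular q \<psi> x"
    unfolding lorentz_modular_def
  proof (rule nn_integral_cong)
    fix s :: real
    let ?d = "distr_fun x (s powr (1 / q))"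
    have "indicator {s. 0 < s \<and> ennreal s < ?F t} s * indicator {0..1} t =
        (indicator {0<..} s * indicator {0..<?d} t :: ennreal)" for t
      using iff[of s t] distr_fun_le_1[of x "s powr (1 / q)"] by (auto simp: indicator_def)
    then show "(\<integral>\<^sup>+t. indicator {s. 0 < s \<and> ennreal s < ?F t} s * indicator {0..1} t \<partial>?\<nu>) =
        ennreal (\<psi> ?d) * indicator {0<..} s"
      by (simp add: nn_integral_cmult emeasure_stieltjes_initial distr_fun_nonneg distr_fun_le_1 mult.commute)
  qed
  finally show ?thesis by (simp add: lorentz_norm_def)
qed

end

section \<open>Distribution functions of disjoint combinations\<close>

lemma distr_fun_scale:
  assumes "a \<noteq> 0"
  shows "distr_fun (\<lambda>t. a * x t) \<tau> = distr_fun x (\<tau> / \<bar>a\<bar>)"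
proof -
  have "{s \<in> {0..1}. \<bar>a * x s\<bar> > \<tau>} = {s \<in> {0..1}. \<bar>x s\<bar> > \<tau> / \<bar>a\<bar>}"
    using assms by (auto simp: abs_mult field_simps)
  then show ?thesis by (simp add: distr_fun_def)
qed

lemma distr_fun_zero: "0 \<le> \<tau> \<Longrightarrow> distr_fun (\<lambda>t. 0) \<tau> = 0"
  by (simp add: distr_fun_def)

lemma distr_fun_sum_disjoint:
  fixes x :: "nat \<Rightarrow> real \<Rightarrow> real"
  assumes x: "\<And>k. k < n \<Longrightarrow> x k \<in> borel_measurable (lebesgue_on {0..1})"
    and disj: "disjoint_family_on (\<lambda>k. {t \<in> {0..1}. x k t \<noteq> 0}) {..<n}" and "0 \<le> \<tau>"
  shows "distr_fun (\<lambda>t. \<Sum>k<n. x k t) \<tau> = (\<Sum>k<n. distr_fun (x k) \<tau>)"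
proof -
  interpret finite_measure "lebesgue_on {0..1::real}" by (rule finite_measure_unit_interval)
  let ?A = "\<lambda>k. {s \<in> {0..1}. \<bar>x k s\<bar> > \<tau>}"
  have one: "(\<Sum>k<n. x k s) = x k s" if "s \<in> {0..1}" "k < n" "x k s \<noteq> 0" for s k
  proof -
    have "x j s = 0" if "j \<in> {..<n} - {k}" for j
    proof (rule ccontr)
      assume "x j s \<noteq> 0"
      then have "s \<in> {t \<in> {0..1}. x j t \<noteq> 0} \<inter> {t \<in> {0..1}. x k t \<noteq> 0}"
        using \<open>s \<in> {0..1}\<close> \<open>x k s \<noteq> 0\<close> by simp
      then show False
        using disjoint_family_onD[OF disj, of j k] \<open>k < n\<close> that by auto
    qed
    then show ?thesis using \<open>k < n\<close> by (simp add: sum.remove[of _ k])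
  qed
  have "{s \<in> {0..1}. \<bar>\<Sum>k<n. x k s\<bar> > \<tau>} = (\<Union>k\<in>{..<n}. ?A k)"
  proof (intro equalityI subsetI)
    fix s assume s: "s \<in> {s \<in> {0..1}. \<bar>\<Sum>k<n. x k s\<bar> > \<tau>}"
    then have "(\<Sum>k<n. x k s) \<noteq> 0" using \<open>0 \<le> \<tau>\<close> by auto
    then obtain k where "k \<in> {..<n}" "x k s \<noteq> 0" by (rule sum.not_neutral_contains_not_neutral)
    then have "k < n" by simp
    with one[of s k] s \<open>x k s \<noteq> 0\<close> show "s \<in> (\<Union>k\<in>{..<n}. ?A k)" by auto
  next
    fix s assume "s \<in> (\<Union>k\<in>{..<n}. ?A k)"
    then obtain k where "k < n" "s \<in> {0..1}" "\<bar>x k s\<bar> > \<tau>" by auto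
    with one[of s k] \<open>0 \<le> \<tau>\<close> show "s \<in> {s \<in> {0..1}. \<bar>\<Sum>k<n. x k s\<bar> > \<tau>}" by auto
  qed
  moreover have "measure (lebesgue_on {0..1}) (\<Union>k\<in>{..<n}. ?A k) =
      (\<Sum>k<n. measure (lebesgue_on {0..1}) (?A k))"
  proof (rule finite_measure_finite_Union)
    show "disjoint_family_on ?A {..<n}"
      using disj \<open>0 \<le> \<tau>\<close> unfolding disjoint_family_on_def by fastforce
    show "?A ` {..<n} \<subseteq> sets (lebesgue_on {0..1})"
      using level_set_sets[OF x] by blast
  qed simp
  ultimately show ?thesis by (simp add: distr_fun_def)
qed

lemma distr_fun_combination:
  fixes x :: "nat \<Rightarrow> real \<Rightarrow> real"
  assumes x: "\<And>k. k < n \<Longrightarrow> x k \<in> borel_measurable (lebesgue_on {0..1})"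
    and disj: "disjoint_family_on (\<lambda>k. {t \<in> {0..1}. x k t \<noteq> 0}) {..<n}" and "0 \<le> \<tau>"
  shows "distr_fun (\<lambda>t. \<Sum>k<n. a k * x k t) \<tau> =
    (\<Sum>k<n. if a k = 0 then 0 else distr_fun (x k) (\<tau> / \<bar>a k\<bar>))"
proof -
  have "distr_fun (\<lambda>t. \<Sum>k<n. a k * x k t) \<tau> = (\<Sum>k<n. distr_fun (\<lambda>t. a k * x k t) \<tau>)"
  proof (rule distr_fun_sum_disjoint)
    show "disjoint_family_on (\<lambda>k. {t \<in> {0..1}. a k * x k t \<noteq> 0}) {..<n}"
      using disj unfolding disjoint_family_on_def by fastforce
    show "(\<lambda>t. a k * x k t) \<in> borel_measurable (lebesgue_on {0..1})" if "k < n" for k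
      using x[OF that] by measurable
  qed fact
  also have "\<dots> = (\<Sum>k<n. if a k = 0 then 0 else distr_fun (x k) (\<tau> / \<bar>a k\<bar>))"
    using \<open>0 \<le> \<tau>\<close> by (intro sum.cong refl) (simp add: distr_fun_scale distr_fun_zero)
  finally show ?thesis .
qed

lemma combination_measurable:
  fixes x :: "nat \<Rightarrow> real \<Rightarrow> real"
  assumes x: "\<And>k. k < n \<Longrightarrow> x k \<in> borel_measurable (lebesgue_on {0..1})"
  shows "(\<lambda>t. \<Sum>k<n. a k * x k t) \<in> borel_measurable (lebesgue_on {0..1})"
  using x by (intro borel_measurable_sum borel_measurable_times) auto

section \<open>Growth exponents of doubling sequences\<close>

text \<open>
  Fekete's lemma: the quotients converge to their infimum \<open>L\<close>. If \<open>f k / k\<close> is close to \<open>L\<close>, division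
  with remainder by \<open>k\<close> bounds \<open>f n\<close> by \<open>(n div k) * f k\<close> plus finitely many possible remainders.
\<close>

lemma fekete:
  fixes f :: "nat \<Rightarrow> real"
  assumes sub: "\<And>m n. f (m + n) \<le> f m + f n" and lower: "\<And>n. - c * real n \<le> f n"
  shows "convergent (\<lambda>n. f n / real n)"
proof -
  define L where "L = (INF n\<in>{1..}. f n / real n)"
  have bdd: "bdd_below ((\<lambda>n. f n / real n) ` {1..})"
  proof (rule bdd_belowI2)
    fix n :: nat assume "n \<in> {1..}"
    then show "- c \<le> f n / real n" using lower[of n] by (simp add: field_simps)
  qed
  have iterate: "f (a * k + r) \<le> real a * f k + f r" for a k r
  proof (induction a)
    case (Suc a)
    have "f (Suc a * k + r) = f (k + (a * k + r))" by (simp add: algebra_simps)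
    also have "\<dots> \<le> f k + f (a * k + r)" by (rule sub)
    finally show ?case using Suc by (simp add: algebra_simps)
  qed simp
  have "(\<lambda>n. f n / real n) \<longlonglongrightarrow> L"
  proof (rule order_tendstoI)
    fix a assume "a < L"
    have "\<forall>\<^sub>F n in sequentially. (1::nat) \<le> n" by (rule eventually_ge_at_top)
    then show "\<forall>\<^sub>F n in sequentially. a < f n / real n"
    proof eventually_elim
      case (elim n)
      then have "L \<le> f n / real n" unfolding L_def by (intro cINF_lower bdd) auto
      with \<open>a < L\<close> show ?case by simp
    qed
  next
    fix b assume "L < b"
    then obtain k where k: "1 \<le> k" "f k / real k < b"
      unfolding L_def using bdd by (subst (asm) cINF_less_iff) auto
    define M where "M = (\<Sum>r<k. \<bar>f r\<bar>)"
    have "(\<lambda>n. f k / real k + (\<bar>f k\<bar> + M) / real n) \<longlonglongrightarrow> f k / real k + 0"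
      by (intro tendsto_add tendsto_const lim_const_over_n)
    then have "\<forall>\<^sub>F n in sequentially. f k / real k + (\<bar>f k\<bar> + M) / real n < b"
      using k by (auto dest: order_tendstoD(2))
    moreover have "\<forall>\<^sub>F n in sequentially. (1::nat) \<le> n" by (rule eventually_ge_at_top)
    ultimately show "\<forall>\<^sub>F n in sequentially. f n / real n < b"
    proof eventually_elim
      case (elim n)
      let ?a = "n div k"
      have n: "real n = real ?a * real k + real (n mod k)"
        by (metis div_mult_mod_eq of_nat_add of_nat_mult)
      have "n mod k < k" using k by simp
      have "f n \<le> real ?a * f k + f (n mod k)" using iterate[of ?a k "n mod k"] by simp
      moreover have "f (n mod k) \<le> M"
      proof -
        have "\<bar>f (n mod k)\<bar> \<le> M"
          unfolding M_def by (rule member_le_sum) (use \<open>n mod k < k\<close> in auto)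
        then show ?thesis by simp
      qed
      moreover have "real ?a * f k \<le> real n / real k * f k + \<bar>f k\<bar>"
      proof -
        have "real n / real k - real ?a = real (n mod k) / real k" using k n by (simp add: field_simps)
        then have "0 \<le> real n / real k - real ?a" "real n / real k - real ?a \<le> 1"
          using \<open>n mod k < k\<close> by (auto simp: field_simps)
        then have "\<bar>real ?a - real n / real k\<bar> * \<bar>f k\<bar> \<le> 1 * \<bar>f k\<bar>"
          by (intro mult_right_mono) auto
        then have "(real ?a - real n / real k) * f k \<le> \<bar>f k\<bar>"
          using abs_ge_self[of "(real ?a - real n / real k) * f k"] by (simp add: abs_mult)
        then show ?thesis by (simp add: algebra_simps)
      qed
      ultimately have "f n \<le> real n / real k * f k + \<bar>f k\<bar> + M" by simp
      then have "f n / real n \<le> (real n / real k * f k + \<bar>f k\<bar> + M) / real n"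
        by (intro divide_right_mono) auto
      also have "\<dots> = f k / real k + (\<bar>f k\<bar> + M) / real n"
        using elim k by (simp add: field_simps)
      finally show ?case using elim by simp
    qed
  qed
  then show ?thesis by (rule convergentI)
qed

text \<open>
  Concavity enters the combinatorial part of the argument only through this property of dyadic
  sequences such as \<open>\<psi> (2 powr -j)\<close>. It is stable under inversion, which lets the
  two indices, and growth and decay, be treated alike.
\<close>

definition doubling :: "(nat \<Rightarrow> real) \<Rightarrow> bool" where
  "doubling v \<longleftrightarrow> (\<forall>j. 0 < v j \<and> v (Suc j) \<le> 2 * v j \<and> v j \<le> 2 * v (Suc j))"

lemma doubling_pos: "doubling v \<Longrightarrow> 0 < v j"
  by (simp add: doubling_def)

lemma doubling_up:
  assumes "doubling v"
  shows "v (j + m) \<le> 2 ^ m * v j"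
proof (induction m)
  case (Suc m)
  have "v (j + Suc m) \<le> 2 * v (j + m)" using assms by (simp add: doubling_def)
  with Suc show ?case by simp
qed simp

lemma doubling_down:
  assumes "doubling v"
  shows "v j \<le> 2 ^ m * v (j + m)"
proof (induction m)
  case (Suc m)
  have "v (j + m) \<le> 2 * v (j + Suc m)" using assms by (simp add: doubling_def)
  then have "2 ^ m * v (j + m) \<le> 2 ^ m * (2 * v (j + Suc m))" by (intro mult_left_mono) auto
  then have "2 ^ m * v (j + m) \<le> 2 ^ Suc m * v (j + Suc m)" by (simp add: mult_ac)
  with Suc show ?case by (rule order_trans)
qed simp

lemma doubling_inverse:
  assumes "doubling v"
  shows "doubling (\<lambda>j. inverse (v j))"
  unfolding doubling_def
proof (intro allI conjI)
  fix j
  have *: "0 < v j" "0 < v (Suc j)" "v (Suc j) \<le> 2 * v j" "v j \<le> 2 * v (Suc j)"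
    using assms by (auto simp: doubling_def)
  then show "0 < inverse (v j)" "inverse (v (Suc j)) \<le> 2 * inverse (v j)"
    "inverse (v j) \<le> 2 * inverse (v (Suc j))" by (auto simp: field_simps)
qed

definition sup_ratio :: "(nat \<Rightarrow> real) \<Rightarrow> nat \<Rightarrow> real" where
  "sup_ratio v m = (SUP j. v (j + m) / v j)"

text \<open>
  For \<open>v j = \<psi> (2 powr -j) powr (1/q)\<close> this is \<open>-\<alpha>\<close>, and for the inverse sequence it is \<open>\<beta>\<close>.
\<close>

definition growth_exponent :: "(nat \<Rightarrow> real) \<Rightarrow> real" where
  "growth_exponent v = lim (\<lambda>m. 1 / real m * log 2 (sup_ratio v m))"

context
  fixes v :: "nat \<Rightarrow> real"
  assumes v: "doubling v"
begin

lemma ratio_le_sup_ratio: "v (j + m) / v j \<le> sup_ratio v m"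
  unfolding sup_ratio_def
proof (rule cSUP_upper)
  show "bdd_above (range (\<lambda>j. v (j + m) / v j))"
    using doubling_up[OF v] doubling_pos[OF v] by (intro bdd_aboveI2[of _ _ "2 ^ m"]) (simp add: field_simps)
qed simp

lemma le_sup_ratio: "v (j + m) \<le> sup_ratio v m * v j"
  using ratio_le_sup_ratio[of j m] doubling_pos[OF v, of j] by (simp add: field_simps)

lemma sup_ratio_le:
  assumes "\<And>j. v (j + m) \<le> c * v j"
  shows "sup_ratio v m \<le> c"
  unfolding sup_ratio_def using assms doubling_pos[OF v]
  by (intro cSUP_least) (auto simp: field_simps)

lemma sup_ratio_ge: "1 / 2 ^ m \<le> sup_ratio v m"
proof -
  have "1 / 2 ^ m \<le> v (0 + m) / v 0"
    using doubling_down[OF v, of 0 m] doubling_pos[OF v, of 0] by (simp add: field_simps)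
  also have "\<dots> \<le> sup_ratio v m" by (rule ratio_le_sup_ratio)
  finally show ?thesis .
qed

lemma sup_ratio_pos: "0 < sup_ratio v m"
  by (rule less_le_trans[OF _ sup_ratio_ge]) simp

lemma sup_ratio_submult: "sup_ratio v (m + n) \<le> sup_ratio v m * sup_ratio v n"
proof (rule sup_ratio_le)
  fix j
  have "v (j + (m + n)) \<le> sup_ratio v n * v (j + m)" using le_sup_ratio[of "j + m" n] by (simp add: add.assoc)
  also have "\<dots> \<le> sup_ratio v n * (sup_ratio v m * v j)"
    using sup_ratio_pos[of n] by (intro mult_left_mono le_sup_ratio) auto
  finally show "v (j + (m + n)) \<le> sup_ratio v m * sup_ratio v n * v j" by (simp add: mult_ac)
qed

lemma growth_exponent_limit:
  "(\<lambda>m. 1 / real m * log 2 (sup_ratio v m)) \<longlonglongrightarrow> growth_exponent v"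
proof -
  have "convergent (\<lambda>m. log 2 (sup_ratio v m) / real m)"
  proof (rule fekete)
    fix m n
    have "log 2 (sup_ratio v (m + n)) \<le> log 2 (sup_ratio v m * sup_ratio v n)"
      using sup_ratio_submult sup_ratio_pos by (intro log_mono) auto
    then show "log 2 (sup_ratio v (m + n)) \<le> log 2 (sup_ratio v m) + log 2 (sup_ratio v n)"
      using sup_ratio_pos[of m] sup_ratio_pos[of n] by (simp add: log_mult)
    have "log 2 (1 / 2 ^ n) \<le> log 2 (sup_ratio v n)"
      using sup_ratio_ge sup_ratio_pos by (intro log_mono) auto
    then show "- 1 * real n \<le> log 2 (sup_ratio v n)" by (simp add: log_divide log_nat_power)
  qed
  then show ?thesis
    unfolding growth_exponent_def by (simp add: convergent_LIMSEQ_iff mult.commute)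
qed

text \<open>
  Since the limit exists, it can be computed along the multiples of a fixed \<open>N\<close>.
\<close>

lemma growth_exponent_leI:
  assumes "0 < N" "0 < C" and le: "\<And>j b. v (j + N * b) \<le> C * 2 powr (\<sigma> * real (N * b)) * v j"
  shows "growth_exponent v \<le> \<sigma>"
proof -
  have "strict_mono (\<lambda>b. N * Suc b)" using \<open>0 < N\<close> by (intro strict_monoI) auto
  then have "((\<lambda>m. 1 / real m * log 2 (sup_ratio v m)) \<circ> (\<lambda>b. N * Suc b)) \<longlonglongrightarrow> growth_exponent v"
    by (rule LIMSEQ_subseq_LIMSEQ[OF growth_exponent_limit])
  moreover have "(\<lambda>b. log 2 C / real N * (1 / real (Suc b)) + \<sigma>) \<longlonglongrightarrow> log 2 C / real N * 0 + \<sigma>"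
    by (intro tendsto_intros LIMSEQ_Suc[OF lim_1_over_n])
  moreover have "((\<lambda>m. 1 / real m * log 2 (sup_ratio v m)) \<circ> (\<lambda>b. N * Suc b)) b
      \<le> log 2 C / real N * (1 / real (Suc b)) + \<sigma>" for b
  proof -
    let ?m = "N * Suc b"
    have "log 2 (sup_ratio v ?m) \<le> log 2 (C * 2 powr (\<sigma> * real ?m))"
      using sup_ratio_pos[of ?m] sup_ratio_le[OF le[of _ "Suc b"]] by (intro log_mono) (simp_all only: one_less_numeral_iff semiring_norm)
    also have "\<dots> = log 2 C + \<sigma> * real ?m" using \<open>0 < C\<close> by (simp add: log_mult)
    finally have "1 / real ?m * log 2 (sup_ratio v ?m) \<le> 1 / real ?m * (log 2 C + \<sigma> * real ?m)"
      by (intro mult_left_mono) auto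
    also have "\<dots> = log 2 C / real N * (1 / real (Suc b)) + \<sigma>"
    proof -
      have "1 / (x * y) * (d + \<sigma> * (x * y)) = d / x * (1 / y) + \<sigma>" if "0 < x" "0 < y" for x y d :: real
        using that by (simp add: field_simps)
      from this[of "real N" "real (Suc b)"] show ?thesis using \<open>0 < N\<close> by (simp only: of_nat_mult)
    qed
    finally show ?thesis by simp
  qed
  ultimately show ?thesis by (auto intro: LIMSEQ_le)
qed

lemma growth_exponent_geI:
  assumes "0 < c" and ge: "\<And>m. c * 2 powr (\<sigma> * real m) \<le> sup_ratio v m"
  shows "\<sigma> \<le> growth_exponent v"
proof (rule LIMSEQ_le)
  show "(\<lambda>m. log 2 c * (1 / real (Suc m)) + \<sigma>) \<longlonglongrightarrow> \<sigma>"
    using tendsto_add[OF tendsto_mult[OF tendsto_const LIMSEQ_Suc[OF lim_1_over_n]] tendsto_const, of "log 2 c" \<sigma>]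
    by simp
  show "(\<lambda>m. 1 / real (Suc m) * log 2 (sup_ratio v (Suc m))) \<longlonglongrightarrow> growth_exponent v"
    by (rule LIMSEQ_Suc[OF growth_exponent_limit])
  have "log 2 c * (1 / real (Suc m)) + \<sigma> \<le> 1 / real (Suc m) * log 2 (sup_ratio v (Suc m))" for m
  proof -
    have "log 2 c + \<sigma> * real (Suc m) = log 2 (c * 2 powr (\<sigma> * real (Suc m)))"
      using \<open>0 < c\<close> by (simp add: log_mult)
    also have "\<dots> \<le> log 2 (sup_ratio v (Suc m))"
      using ge \<open>0 < c\<close> by (intro log_mono) (simp_all del: of_nat_Suc)
    finally have "1 / real (Suc m) * (log 2 c + \<sigma> * real (Suc m)) \<le> 1 / real (Suc m) * log 2 (sup_ratio v (Suc m))"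
      by (intro mult_left_mono) auto
    then show ?thesis by (simp add: field_simps del: of_nat_Suc)
  qed
  then show "\<exists>N. \<forall>n\<ge>N. log 2 c * (1 / real (Suc n)) + \<sigma> \<le> 1 / real (Suc n) * log 2 (sup_ratio v (Suc n))"
    by blast
qed

text \<open>
  Doubling over each step of a single arithmetic progression already forces geometric growth
  everywhere: a position differs from a point of the progression by less than \<open>N\<close> steps, and the
  positions before its start by at most \<open>a\<close> steps, each of which costs at most a factor \<open>2\<close>.
\<close>

lemma geometric_growth_extends:
  assumes "0 < N" and step: "\<And>l. 2 * v (a + N * l) \<le> v (a + N * Suc l)"
  shows "\<exists>C>0. \<forall>j b. 2 ^ b * v j \<le> C * v (j + N * b)"
proof -
  have four: "(4::real) ^ k = 2 ^ k * 2 ^ k" for k by (simp flip: power_mult_distrib)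
  have grid: "2 ^ b * v (a + N * l) \<le> v (a + N * (l + b))" for l b
  proof (induction b)
    case (Suc b)
    with step[of "l + b"] show ?case by simp
  qed simp
  have far: "2 ^ b * v j \<le> 4 ^ N * v (j + N * b)" if "a \<le> j" for j b
  proof -
    define l r where "l = (j - a) div N" and "r = (j - a) mod N"
    have "j - a = N * l + r" unfolding l_def r_def by simp
    then have j: "j = a + N * l + r" using that by linarith
    have "r < N" using \<open>0 < N\<close> by (simp add: r_def)
    then have r: "(2::real) ^ r \<le> 2 ^ N" by (intro power_increasing) auto
    have pos: "0 < v i" for i by (rule doubling_pos[OF v])
    have "v j \<le> 2 ^ r * v (a + N * l)" using doubling_up[OF v, of "a + N * l" r] by (simp add: j)
    also have "\<dots> \<le> 2 ^ N * v (a + N * l)" using r pos by (intro mult_right_mono) (auto intro: less_imp_le)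
    finally have "2 ^ b * v j \<le> 2 ^ N * (2 ^ b * v (a + N * l))" by (simp add: mult_ac)
    also have "\<dots> \<le> 2 ^ N * v (a + N * (l + b))" by (intro mult_left_mono grid) auto
    also have "\<dots> \<le> 2 ^ N * (2 ^ r * v (a + N * (l + b) + r))"
      by (intro mult_left_mono doubling_down[OF v]) auto
    also have "\<dots> \<le> 2 ^ N * (2 ^ N * v (a + N * (l + b) + r))"
      using r pos by (intro mult_left_mono mult_right_mono) (auto intro: less_imp_le)
    also have "\<dots> = 4 ^ N * v (j + N * b)"
      by (simp add: j four algebra_simps)
    finally show ?thesis .
  qed
  have "2 ^ b * v j \<le> (4 ^ N * 4 ^ a) * v (j + N * b)" for j b
  proof -
    have pos: "0 < v i" for i by (rule doubling_pos[OF v])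
    have "v j \<le> 2 ^ a * v (j + a)" by (rule doubling_down[OF v])
    then have "2 ^ b * v j \<le> 2 ^ a * (2 ^ b * v (j + a))" by (simp add: mult_ac)
    also have "\<dots> \<le> 2 ^ a * (4 ^ N * v (j + a + N * b))" by (intro mult_left_mono far) auto
    also have "\<dots> \<le> 2 ^ a * (4 ^ N * (2 ^ a * v (j + N * b)))"
      using doubling_up[OF v, of "j + N * b" a] by (intro mult_left_mono) (auto simp: add_ac)
    also have "\<dots> = (4 ^ N * 4 ^ a) * v (j + N * b)"
      by (simp add: four mult_ac add_ac)
    finally show ?thesis .
  qed
  then show ?thesis by (intro exI[of _ "4 ^ N * 4 ^ a"]) auto
qed

end

section \<open>Windows with light ends\<close>

text \<open>
  Having heavy ends in every window is a form of convexity. Around any \<open>m\<close>, either all values to the left or all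
  values to the right (within distance \<open>N\<close>) are at least \<open>\<delta>/2 * W m\<close>, since otherwise a window
  with too light ends would surround \<open>m\<close>. Summing the \<open>N\<close> values on that side, the value at its far
  end is at least \<open>2 * W m\<close>. On a grid of mesh \<open>N\<close>, a step up by a factor \<open>2\<close> excludes the alternative
  at the next grid point, so once the sequence goes up it goes up forever.
\<close>

lemma window_or_geometric:
  assumes W: "doubling W" and "0 < \<delta>" "\<delta> \<le> 1"
    and heavy: "\<And>i j. J \<le> i \<Longrightarrow> i < j \<Longrightarrow> \<delta> * (\<Sum>l\<in>{i<..j}. W l) < W i + W j"
  obtains N C where "0 < N" "0 < C" "\<And>j b. 2 ^ b * W j \<le> C * W (j + N * b)"
  | N C where "0 < N" "0 < C" "\<And>j b. 2 ^ b * W (j + N * b) \<le> C * W j"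
proof -
  have pos: "0 < W i" for i by (rule doubling_pos[OF W])
  \<comment> \<open>With this N the sum over N neighbours exceeds 3 W m / \<delta>, so that the two ends of the window together exceed 3 W m.\<close>
  obtain N where N: "6 / \<delta>\<^sup>2 < real N" using reals_Archimedean2 by blast
  then have N': "3 \<le> real N * (\<delta> / 2) * \<delta>" using \<open>0 < \<delta>\<close> by (simp add: field_simps power2_eq_square)
  have "0 < N" using N \<open>0 < \<delta>\<close> by (cases N) (auto simp: field_simps)
  have either: "2 * W m \<le> W (m - N) \<or> 2 * W m \<le> W (m + N)" if m: "J + N \<le> m" for m
  proof -
    have "(\<forall>i\<in>{m-N..<m}. \<delta> / 2 * W m \<le> W i) \<or> (\<forall>k\<in>{m<..m+N}. \<delta> / 2 * W m \<le> W k)"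
    proof (rule ccontr)
      assume "\<not> ?thesis"
      then obtain i k where ik: "m - N \<le> i" "i < m" "m < k" "W i < \<delta> / 2 * W m" "W k < \<delta> / 2 * W m"
        by auto
      have "W m \<le> (\<Sum>l\<in>{i<..k}. W l)"
        using ik pos by (intro member_le_sum) (auto intro: less_imp_le)
      then have "\<delta> * W m \<le> \<delta> * (\<Sum>l\<in>{i<..k}. W l)" using \<open>0 < \<delta>\<close> by (intro mult_left_mono) auto
      also have "\<dots> < W i + W k" using ik m by (intro heavy) auto
      finally show False using ik by simp
    qed
    then show ?thesis
    proof
      assume left: "\<forall>i\<in>{m-N..<m}. \<delta> / 2 * W m \<le> W i"
      have "(\<Sum>l\<in>{m-N<..m}. \<delta> / 2 * W m) \<le> (\<Sum>l\<in>{m-N<..m}. W l)"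
      proof (rule sum_mono)
        fix l assume "l \<in> {m-N<..m}"
        moreover have "\<delta> / 2 * W m \<le> 1 * W m"
          using \<open>\<delta> \<le> 1\<close> pos[of m] by (intro mult_right_mono) auto
        ultimately show "\<delta> / 2 * W m \<le> W l" using left by (cases "l = m") auto
      qed
      then have "real N * (\<delta> / 2 * W m) \<le> (\<Sum>l\<in>{m-N<..m}. W l)" using m by simp
      then have "\<delta> * (real N * (\<delta> / 2 * W m)) \<le> \<delta> * (\<Sum>l\<in>{m-N<..m}. W l)"
        using \<open>0 < \<delta>\<close> by (intro mult_left_mono) auto
      also have "\<dots> < W (m - N) + W m" using m \<open>0 < N\<close> by (intro heavy) auto
      finally have "real N * (\<delta> / 2) * \<delta> * W m < W (m - N) + W m" by (simp add: mult_ac)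
      moreover have "3 * W m \<le> real N * (\<delta> / 2) * \<delta> * W m"
        using N' pos[of m] by (intro mult_right_mono) auto
      ultimately show ?thesis by simp
    next
      assume right: "\<forall>k\<in>{m<..m+N}. \<delta> / 2 * W m \<le> W k"
      have "(\<Sum>l\<in>{m<..m+N}. \<delta> / 2 * W m) \<le> (\<Sum>l\<in>{m<..m+N}. W l)"
        using right by (intro sum_mono) auto
      then have "real N * (\<delta> / 2 * W m) \<le> (\<Sum>l\<in>{m<..m+N}. W l)" by simp
      then have "\<delta> * (real N * (\<delta> / 2 * W m)) \<le> \<delta> * (\<Sum>l\<in>{m<..m+N}. W l)"
        using \<open>0 < \<delta>\<close> by (intro mult_left_mono) auto
      also have "\<dots> < W m + W (m + N)" using m \<open>0 < N\<close> by (intro heavy) auto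
      finally have "real N * (\<delta> / 2) * \<delta> * W m < W m + W (m + N)" by (simp add: mult_ac)
      moreover have "3 * W m \<le> real N * (\<delta> / 2) * \<delta> * W m"
        using N' pos[of m] by (intro mult_right_mono) auto
      ultimately show ?thesis by simp
    qed
  qed
  define Z where "Z l = W (J + N * l)" for l
  have Z: "2 * Z (Suc l) \<le> Z l \<or> 2 * Z (Suc l) \<le> Z (Suc (Suc l))" for l
    using either[of "J + N * Suc l"] by (simp add: Z_def algebra_simps)
  show thesis
  proof (cases "\<exists>l. 2 * Z l \<le> Z (Suc l)")
    case True
    then obtain l0 where "2 * Z l0 \<le> Z (Suc l0)" by blast
    then have grow: "2 * Z (l0 + l) \<le> Z (Suc (l0 + l))" for l
    proof (induction l)
      case (Suc l)
      then have IH: "2 * Z (l0 + l) \<le> Z (Suc (l0 + l))" by simp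
      moreover have "0 < Z (l0 + l)" by (simp add: Z_def pos)
      ultimately have "\<not> 2 * Z (Suc (l0 + l)) \<le> Z (l0 + l)" by linarith
      with Z[of "l0 + l"] show ?case by simp
    qed simp
    have "2 * W ((J + N * l0) + N * l) \<le> W ((J + N * l0) + N * Suc l)" for l
      using grow[of l] by (simp add: Z_def add_mult_distrib2 add_ac)
    from geometric_growth_extends[OF W \<open>0 < N\<close> this] show thesis using that(1) \<open>0 < N\<close> by blast
  next
    case False
    then have decay: "2 * Z (Suc l) \<le> Z l" for l using Z[of l] by blast
    have "2 * inverse (Z l) \<le> inverse (Z (Suc l))" for l
      using decay[of l] pos[of "J + N * l"] pos[of "J + N * Suc l"] by (fold Z_def) (simp add: field_simps)
    then have "2 * inverse (W (J + N * l)) \<le> inverse (W (J + N * Suc l))" for l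
      by (simp only: Z_def)
    from geometric_growth_extends[OF doubling_inverse[OF W] \<open>0 < N\<close> this]
    obtain C where C: "0 < C" "\<And>j b. 2 ^ b * inverse (W j) \<le> C * inverse (W (j + N * b))" by blast
    have "2 ^ b * W (j + N * b) \<le> C * W j" for j b
      using C(2)[of b j] pos[of j] pos[of "j + N * b"] by (simp add: field_simps)
    then show thesis using that(2) \<open>0 < N\<close> \<open>0 < C\<close> by blast
  qed
qed

section \<open>The indices as growth exponents\<close>

context concave_weight
begin

definition dyadic :: "nat \<Rightarrow> real" where "dyadic j = \<psi> ((1 / 2) ^ j)"

lemma dyadic_pos: "0 < dyadic j"
  unfolding dyadic_def by (rule weight_pos) (auto simp: power_le_one)

lemma dyadic_Suc: "dyadic (Suc j) \<le> dyadic j" "dyadic j \<le> 2 * dyadic (Suc j)"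
proof -
  have *: "0 < (1 / 2 :: real) ^ j" "(1 / 2 :: real) ^ j \<le> 1" by (auto simp: power_le_one)
  show "dyadic (Suc j) \<le> dyadic j"
    unfolding dyadic_def using * by (intro weight_mono) auto
  show "dyadic j \<le> 2 * dyadic (Suc j)"
    unfolding dyadic_def using * weight_compare[of "(1 / 2) ^ Suc j" "(1 / 2) ^ j"] by simp
qed

text \<open>
  The two parameters cover both uses: \<open>\<theta> = 0\<close> gives the sequences that define the indices, and \<open>r = 1\<close>
  gives the weights \<open>W\<close> of the windows.
\<close>

lemma doubling_powr_tilt:
  assumes "0 < r" "r \<le> 1" "0 \<le> \<theta>" "\<theta> \<le> r"
  shows "doubling (\<lambda>j. 2 powr (\<theta> * real j) * dyadic j powr r)"
  unfolding doubling_def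
proof (intro allI conjI)
  fix j
  show "0 < 2 powr (\<theta> * real j) * dyadic j powr r" using dyadic_pos[of j] by simp
  have split: "(2::real) powr (\<theta> * real (Suc j)) = 2 powr \<theta> * 2 powr (\<theta> * real j)"
    by (simp add: algebra_simps flip: powr_add)
  have up: "dyadic (Suc j) powr r \<le> dyadic j powr r"
    using dyadic_Suc dyadic_pos assms by (intro powr_mono2) (auto intro: less_imp_le)
  have "dyadic j powr r \<le> (2 * dyadic (Suc j)) powr r"
    using dyadic_Suc dyadic_pos assms by (intro powr_mono2) (auto intro: less_imp_le)
  also have "\<dots> = 2 powr r * dyadic (Suc j) powr r"
    using dyadic_pos[of "Suc j"] by (simp add: powr_mult)
  also have "\<dots> \<le> 2 * dyadic (Suc j) powr r"
    using powr_mono[of r 1 "2::real"] assms by (intro mult_right_mono) auto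
  finally have down: "dyadic j powr r \<le> 2 * dyadic (Suc j) powr r" .
  have \<theta>: "1 \<le> 2 powr \<theta>" "2 powr \<theta> \<le> 2"
    using powr_mono[of 0 \<theta> "2::real"] powr_mono[of \<theta> 1 "2::real"] assms by auto
  have "2 powr \<theta> * (2 powr (\<theta> * real j) * dyadic (Suc j) powr r) \<le> 2 * (2 powr (\<theta> * real j) * dyadic j powr r)"
    using \<theta> up by (intro mult_mono) auto
  then show "2 powr (\<theta> * real (Suc j)) * dyadic (Suc j) powr r \<le> 2 * (2 powr (\<theta> * real j) * dyadic j powr r)"
    unfolding split by (simp add: mult_ac)
  have "1 * (2 powr (\<theta> * real j) * dyadic j powr r)
      \<le> 2 powr \<theta> * (2 powr (\<theta> * real j) * (2 * dyadic (Suc j) powr r))"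
    using \<theta> down by (intro mult_mono) auto
  then show "2 powr (\<theta> * real j) * dyadic j powr r \<le> 2 * (2 powr (\<theta> * real (Suc j)) * dyadic (Suc j) powr r)"
    unfolding split by (simp add: mult_ac)
qed

lemma doubling_dyadic_powr: "0 < r \<Longrightarrow> r \<le> 1 \<Longrightarrow> doubling (\<lambda>j. dyadic j powr r)"
  using doubling_powr_tilt[of r 0] by simp

lemma SUP_nonpos_int: "(SUP k\<in>{..0::int}. f k) = (SUP j::nat. f (- int j))"
proof -
  have "{..0::int} = range (\<lambda>j. - int j)"
  proof (intro equalityI subsetI)
    fix k :: int assume "k \<in> {..0}"
    then have "k = - int (nat (- k))" by simp
    then show "k \<in> range (\<lambda>j. - int j)" by blast
  qed auto
  then show ?thesis by (simp add: image_image)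
qed

lemma powi_dyadic: "\<psi> (2 powi (- int j)) = dyadic j" "\<psi> (2 powi (- int j - int n)) = dyadic (j + n)"
proof -
  have *: "(2::real) powi (- int i) = (1 / 2) ^ i" for i
    by (simp add: power_int_minus power_divide field_simps)
  show "\<psi> (2 powi (- int j)) = dyadic j" by (simp add: dyadic_def *)
  have "- int j - int n = - int (j + n)" by simp
  then show "\<psi> (2 powi (- int j - int n)) = dyadic (j + n)" by (simp only: dyadic_def *)
qed

lemma alpha_index_eq:
  assumes "1 \<le> q"
  shows "alpha_index q \<psi> = - growth_exponent (\<lambda>j. dyadic j powr (1 / q))"
proof -
  have "(dyadic (j + n) / dyadic j) powr (1 / q) = dyadic (j + n) powr (1 / q) / dyadic j powr (1 / q)" for j n
    by (rule powr_divide)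
  then show ?thesis
    unfolding alpha_index_def growth_exponent_def sup_ratio_def SUP_nonpos_int powi_dyadic by simp
qed

lemma beta_index_eq:
  assumes "1 \<le> q"
  shows "beta_index q \<psi> = growth_exponent (\<lambda>j. inverse (dyadic j powr (1 / q)))"
proof -
  have "(dyadic j / dyadic (j + n)) powr (1 / q) =
      inverse (dyadic (j + n) powr (1 / q)) / inverse (dyadic j powr (1 / q))" for j n
    using dyadic_pos[of j] dyadic_pos[of "j + n"] powr_divide[of "dyadic j" "dyadic (j + n)" "1 / q"]
    by (simp add: field_simps)
  then show ?thesis
    unfolding beta_index_def growth_exponent_def sup_ratio_def SUP_nonpos_int powi_dyadic by simp
qed

lemma dyadic_root_antimono:
  assumes "1 \<le> q"
  shows "dyadic (j + m) powr (1 / q) \<le> dyadic j powr (1 / q)"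
proof -
  have "dyadic (j + m) \<le> dyadic j"
    by (induction m) (auto intro: order_trans dyadic_Suc)
  with dyadic_pos assms show ?thesis by (intro powr_mono2) (auto intro: less_imp_le)
qed

lemma alpha_index_nonneg:
  assumes "1 \<le> q"
  shows "0 \<le> alpha_index q \<psi>"
proof -
  have "doubling (\<lambda>j. dyadic j powr (1 / q))" using assms by (intro doubling_dyadic_powr) auto
  from growth_exponent_leI[OF this, of 1 1 0]
  have "growth_exponent (\<lambda>j. dyadic j powr (1 / q)) \<le> 0"
    using dyadic_root_antimono[OF assms] by simp
  then show ?thesis by (simp add: alpha_index_eq[OF assms])
qed

lemma beta_index_bounds:
  assumes "1 \<le> q"
  shows "0 \<le> beta_index q \<psi>" "beta_index q \<psi> \<le> 1 / q"
proof -
  let ?v = "\<lambda>j. inverse (dyadic j powr (1 / q))"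
  have v: "doubling ?v" using assms by (intro doubling_inverse doubling_dyadic_powr) auto
  have pos: "0 < dyadic j powr (1 / q)" for j using dyadic_pos[of j] by simp
  have "1 \<le> ?v (0 + m) / ?v 0" for m
    using dyadic_root_antimono[OF assms, of 0 m] pos[of 0] pos[of m] by (simp add: field_simps)
  then have "1 \<le> sup_ratio ?v m" for m
    using ratio_le_sup_ratio[OF v, of 0 m] order_trans by blast
  then show "0 \<le> beta_index q \<psi>"
    unfolding beta_index_eq[OF assms] by (intro growth_exponent_geI[OF v, of 1]) auto
  have "?v (j + 1 * b) \<le> 1 * 2 powr (1 / q * real (1 * b)) * ?v j" for j b
  proof -
    have "dyadic j \<le> 2 ^ b * dyadic (j + b)"
      using doubling_down[OF doubling_dyadic_powr[of 1], of j b] dyadic_pos by (simp add: less_imp_le)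
    then have "dyadic j powr (1 / q) \<le> (2 ^ b * dyadic (j + b)) powr (1 / q)"
      using dyadic_pos assms by (intro powr_mono2) (auto intro: less_imp_le)
    also have "\<dots> = 2 powr (1 / q * real b) * dyadic (j + b) powr (1 / q)"
      using dyadic_pos[of "j + b"] by (simp add: powr_mult powr_powr mult.commute flip: powr_realpow)
    finally show ?thesis using pos[of j] pos[of "j + b"] by (simp add: field_simps)
  qed
  then show "beta_index q \<psi> \<le> 1 / q"
    unfolding beta_index_eq[OF assms] by (intro growth_exponent_leI[OF v, of 1 1]) auto
qed

text \<open>
  Geometric growth of the tilted sequence, at whatever rate \<open>1/N\<close>, pushes \<open>\<beta>\<close> strictly below \<open>\<theta>\<close>, and
  geometric decay pushes \<open>\<alpha>\<close> strictly above it.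
\<close>

lemma window_exists:
  assumes q: "1 \<le> q" and \<theta>: "0 \<le> \<theta>" and "alpha_index q \<psi> \<le> \<theta>" "\<theta> \<le> beta_index q \<psi>"
    and "0 < \<delta>"
  shows "\<exists>i j. J \<le> i \<and> i < j \<and>
    2 powr (q * \<theta> * real i) * dyadic i + 2 powr (q * \<theta> * real j) * dyadic j
      \<le> \<delta> * (\<Sum>l\<in>{i<..j}. 2 powr (q * \<theta> * real l) * dyadic l)"
proof (rule ccontr)
  define W where "W j = 2 powr (q * \<theta> * real j) * dyadic j" for j
  assume "\<not> ?thesis"
  then have no: "\<And>i j. J \<le> i \<Longrightarrow> i < j \<Longrightarrow> \<not> W i + W j \<le> \<delta> * (\<Sum>l\<in>{i<..j}. W l)"
    unfolding W_def by blast
  have "q * \<theta> \<le> q * (1 / q)"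
    using beta_index_bounds(2)[OF q] \<open>\<theta> \<le> beta_index q \<psi>\<close> q by (intro mult_left_mono) auto
  then have "q * \<theta> \<le> 1" using q by simp
  then have W: "doubling W"
    using doubling_powr_tilt[of 1 "q * \<theta>"] q \<theta> dyadic_pos unfolding W_def by (simp add: less_imp_le)
  have root: "W j powr (1 / q) = 2 powr (\<theta> * real j) * dyadic j powr (1 / q)" for j
    using q dyadic_pos[of j] by (simp add: W_def powr_mult powr_powr)
  have dpos: "0 < dyadic j powr (1 / q)" for j using dyadic_pos[of j] by simp
  \<comment> \<open>The indices are defined with q-th roots, the windows without.\<close>
  have key: "2 powr (real b / q) * A powr (1 / q) \<le> C powr (1 / q) * B powr (1 / q)"
    if "2 ^ b * A \<le> C * B" "0 < A" "0 < B" "0 < C" for A B C :: real and b :: nat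
  proof -
    have "(2 ^ b * A) powr (1 / q) \<le> (C * B) powr (1 / q)"
      using that q by (intro powr_mono2) auto
    then show ?thesis using that by (simp add: powr_mult powr_powr flip: powr_realpow)
  qed
  have "\<delta> * s \<ge> min \<delta> 1 * s" if "0 \<le> s" for s using that by (intro mult_right_mono) auto
  moreover have "0 \<le> (\<Sum>l\<in>{i<..j}. W l)" for i j
    using doubling_pos[OF W] by (intro sum_nonneg) (auto intro: less_imp_le)
  ultimately have heavy: "min \<delta> 1 * (\<Sum>l\<in>{i<..j}. W l) < W i + W j" if "J \<le> i" "i < j" for i j
    using no[OF that] by (meson le_less_trans not_le)
  show False
  proof (rule window_or_geometric[OF W _ _ heavy])
    show "0 < min \<delta> 1" "min \<delta> 1 \<le> 1" using \<open>0 < \<delta>\<close> by auto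
  next
    fix N C assume N: "0 < N" "0 < C" and *: "\<And>j b. 2 ^ b * W j \<le> C * W (j + N * b)"
    have v: "doubling (\<lambda>j. inverse (dyadic j powr (1 / q)))"
      using q by (intro doubling_inverse doubling_dyadic_powr) auto
    have "beta_index q \<psi> \<le> \<theta> - 1 / (q * real N)"
      unfolding beta_index_eq[OF q]
    proof (rule growth_exponent_leI[OF v, of N "C powr (1 / q)"])
      fix j b
      have "2 powr (real b / q) * W j powr (1 / q) \<le> C powr (1 / q) * W (j + N * b) powr (1 / q)"
        using key[OF *] doubling_pos[OF W] N by auto
      then have "2 powr (real b / q) * dyadic j powr (1 / q) \<le>
          C powr (1 / q) * 2 powr (\<theta> * real (N * b)) * dyadic (j + N * b) powr (1 / q)"
        by (simp add: root powr_add distrib_left)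
      then have "dyadic j powr (1 / q) \<le>
          C powr (1 / q) * (2 powr (\<theta> * real (N * b)) / 2 powr (real b / q)) * dyadic (j + N * b) powr (1 / q)"
        by (simp add: field_simps)
      also have "2 powr (\<theta> * real (N * b)) / 2 powr (real b / q) = 2 powr ((\<theta> - 1 / (q * real N)) * real (N * b))"
      proof -
        have "(\<theta> - 1 / (q * real N)) * real (N * b) = \<theta> * real (N * b) - real b / q"
          using N q by (simp add: field_simps)
        then show ?thesis by (simp only: powr_diff)
      qed
      finally show "inverse (dyadic (j + N * b) powr (1 / q)) \<le>
          C powr (1 / q) * 2 powr ((\<theta> - 1 / (q * real N)) * real (N * b)) * inverse (dyadic j powr (1 / q))"
        using dpos[of j] dpos[of "j + N * b"] by (simp add: field_simps)
    qed (use N in auto)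
    moreover have "0 < 1 / (q * real N)" using q N by simp
    ultimately show False using \<open>\<theta> \<le> beta_index q \<psi>\<close> by linarith
  next
    fix N C assume N: "0 < N" "0 < C" and *: "\<And>j b. 2 ^ b * W (j + N * b) \<le> C * W j"
    have v: "doubling (\<lambda>j. dyadic j powr (1 / q))"
      using q by (intro doubling_dyadic_powr) auto
    have "growth_exponent (\<lambda>j. dyadic j powr (1 / q)) \<le> - \<theta> - 1 / (q * real N)"
    proof (rule growth_exponent_leI[OF v, of N "C powr (1 / q)"])
      fix j b
      have "2 powr (real b / q) * W (j + N * b) powr (1 / q) \<le> C powr (1 / q) * W j powr (1 / q)"
        using key[OF *] doubling_pos[OF W] N by auto
      then have "2 powr (real b / q) * 2 powr (\<theta> * real (N * b)) * dyadic (j + N * b) powr (1 / q) \<le>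
          C powr (1 / q) * dyadic j powr (1 / q)"
        by (simp add: root powr_add distrib_left)
      then have "dyadic (j + N * b) powr (1 / q) \<le>
          C powr (1 / q) * (1 / (2 powr (real b / q) * 2 powr (\<theta> * real (N * b)))) * dyadic j powr (1 / q)"
        by (simp add: field_simps)
      also have "1 / (2 powr (real b / q) * 2 powr (\<theta> * real (N * b))) = 2 powr ((- \<theta> - 1 / (q * real N)) * real (N * b))"
      proof -
        have "(- \<theta> - 1 / (q * real N)) * real (N * b) = - (real b / q + \<theta> * real (N * b))"
          using N q by (simp add: field_simps)
        then show ?thesis by (simp only: powr_minus_divide powr_add)
      qed
      finally show "dyadic (j + N * b) powr (1 / q) \<le>
          C powr (1 / q) * 2 powr ((- \<theta> - 1 / (q * real N)) * real (N * b)) * dyadic j powr (1 / q)" .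
    qed (use N in auto)
    moreover have "0 < 1 / (q * real N)" using q N by simp
    ultimately show False using \<open>alpha_index q \<psi> \<le> \<theta>\<close> unfolding alpha_index_eq[OF q] by linarith
  qed
qed

end

section \<open>A criterion for symmetric finite representability\<close>

text \<open>
  The reciprocal as a real number, so that \<open>p = \<infinity>\<close> corresponds to \<open>0\<close> and both ends of the
  interval of exponents become inequalities between real numbers.
\<close>

definition recip :: "ereal \<Rightarrow> real" where
  "recip p = (if p = \<infinity> then 0 else 1 / real_of_ereal p)"

lemma reciprocal_interval_iff:
  assumes "1 \<le> p" "0 \<le> \<alpha>" "0 \<le> \<beta>"
  shows "p \<in> {1 / ereal \<beta> .. 1 / ereal \<alpha>} \<longleftrightarrow> \<alpha> \<le> recip p \<and> recip p \<le> \<beta>"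
proof (cases p)
  case (real r)
  with assms have "1 \<le> r" by simp
  have "1 / ereal \<beta> \<le> ereal r \<longleftrightarrow> 1 / r \<le> \<beta>"
    using \<open>1 \<le> r\<close> \<open>0 \<le> \<beta>\<close> by (cases "\<beta> = 0") (auto simp: divide_ereal_def field_simps)
  moreover have "ereal r \<le> 1 / ereal \<alpha> \<longleftrightarrow> \<alpha> \<le> 1 / r"
    using \<open>1 \<le> r\<close> \<open>0 \<le> \<alpha>\<close> by (cases "\<alpha> = 0") (auto simp: divide_ereal_def field_simps)
  ultimately show ?thesis using real by (auto simp: recip_def)
next
  case PInf
  have "1 / ereal \<alpha> = \<infinity> \<longleftrightarrow> \<alpha> \<le> 0"
    using \<open>0 \<le> \<alpha>\<close> by (cases "\<alpha> = 0") (auto simp: divide_ereal_def)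
  with PInf assms show ?thesis by (auto simp: recip_def)
qed (use assms in auto)

lemma lp_norm_ones:
  assumes "1 \<le> p" "1 \<le> n"
  shows "lp_norm p n (\<lambda>k. 1) = real n powr recip p"
proof -
  have "(\<lambda>k. \<bar>1::real\<bar>) ` {..<n} = {1}" using assms by (auto intro!: image_eqI[of _ _ 0])
  then show ?thesis using assms by (simp add: lp_norm_def recip_def)
qed

lemma lp_norm_unit:
  assumes "1 \<le> p" "m < n"
  shows "lp_norm p n (\<lambda>k. if k = m then 1 else 0) = 1"
proof (cases "p = \<infinity>")
  case True
  have "Max ((\<lambda>k. \<bar>if k = m then 1 else (0::real)\<bar>) ` {..<n}) = 1"
    by (rule Max_eqI) (use \<open>m < n\<close> in \<open>auto intro!: image_eqI[of _ _ m]\<close>)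
  with True show ?thesis by (simp add: lp_norm_def)
next
  case False
  have "(\<Sum>k<n. \<bar>if k = m then 1 else (0::real)\<bar> powr real_of_ereal p) =
      (\<Sum>k<n. if k = m then 1 else 0)"
    by (intro sum.cong) auto
  with False \<open>m < n\<close> show ?thesis by (simp add: lp_norm_def)
qed

lemma lp_norm_nonneg:
  assumes "1 \<le> n"
  shows "0 \<le> lp_norm p n a"
proof -
  have "0 \<le> \<bar>a 0\<bar>" by simp
  also have "\<bar>a 0\<bar> \<le> Max ((\<lambda>k. \<bar>a k\<bar>) ` {..<n})" using assms by (intro Max_ge) auto
  finally show ?thesis by (simp add: lp_norm_def)
qed

lemma lp_norm_zeroD:
  assumes "1 \<le> p" "lp_norm p n a = 0" "k < n"
  shows "a k = 0"
proof (cases "p = \<infinity>")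
  case True
  have "\<bar>a k\<bar> \<le> Max ((\<lambda>k. \<bar>a k\<bar>) ` {..<n})" using assms by (intro Max_ge) auto
  with True assms show ?thesis by (simp add: lp_norm_def)
next
  case False
  with assms have "(\<Sum>k<n. \<bar>a k\<bar> powr real_of_ereal p) = 0" by (simp add: lp_norm_def)
  then show ?thesis using \<open>k < n\<close> by (subst (asm) sum_nonneg_eq_0_iff) auto
qed

lemma lp_norm_divide:
  assumes "1 \<le> p" "1 \<le> n" "0 < c"
  shows "lp_norm p n (\<lambda>k. a k / c) = lp_norm p n a / c"
proof (cases "p = \<infinity>")
  case True
  have "Max ((\<lambda>u. u / c) ` (\<lambda>k. \<bar>a k\<bar>) ` {..<n}) = Max ((\<lambda>k. \<bar>a k\<bar>) ` {..<n}) / c"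
    using assms by (intro mono_Max_commute[symmetric]) (auto simp: mono_def divide_right_mono lessThan_empty_iff)
  with True \<open>0 < c\<close> show ?thesis by (simp add: lp_norm_def image_image)
next
  case False
  with \<open>1 \<le> p\<close> have r: "1 \<le> real_of_ereal p" by (cases p) auto
  let ?r = "real_of_ereal p"
  have "(\<Sum>k<n. \<bar>a k / c\<bar> powr ?r) = (\<Sum>k<n. \<bar>a k\<bar> powr ?r) / c powr ?r"
    using \<open>0 < c\<close> by (simp add: powr_divide sum_divide_distrib)
  also have "\<dots> powr (1 / ?r) = (\<Sum>k<n. \<bar>a k\<bar> powr ?r) powr (1 / ?r) / c"
    using \<open>0 < c\<close> r by (simp add: powr_divide powr_powr)
  finally show ?thesis using False by (simp add: lp_norm_def)
qed

text \<open>
  Substitution \<open>s \<mapsto> \<bar>c\<bar> powr q * s\<close> in the layer-cake integral.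
\<close>

lemma lorentz_modular_scale:
  assumes "0 < q" "c \<noteq> 0" and meas: "(\<lambda>s. ennreal (\<psi> (distr_fun x (s powr (1 / q))))) \<in> borel_measurable borel"
  shows "lorentz_modular q \<psi> (\<lambda>t. c * x t) = ennreal (\<bar>c\<bar> powr q) * lorentz_modular q \<psi> x"
proof -
  define d where "d = \<bar>c\<bar> powr q"
  have "0 < d" using \<open>c \<noteq> 0\<close> by (simp add: d_def)
  have root: "(d * s) powr (1 / q) = \<bar>c\<bar> * s powr (1 / q)" if "0 < s" for s
    using that \<open>0 < d\<close> \<open>0 < q\<close> by (simp add: powr_mult d_def powr_powr)
  let ?f = "\<lambda>s. ennreal (\<psi> (distr_fun x (s powr (1 / q)))) * indicator {0<..} s"
  let ?g = "\<lambda>s. ennreal (\<psi> (distr_fun (\<lambda>t. c * x t) (s powr (1 / q)))) * indicator {0<..} s"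
  have g: "?g s = ?f (0 + inverse d * s)" for s
  proof (cases "0 < s")
    case True
    have "s powr (1 / q) = \<bar>c\<bar> * (inverse d * s) powr (1 / q)"
      using root[of "inverse d * s"] True \<open>0 < d\<close> by (simp add: field_simps)
    then have "s powr (1 / q) / \<bar>c\<bar> = (inverse d * s) powr (1 / q)" using \<open>c \<noteq> 0\<close> by (simp add: field_simps)
    then show ?thesis using True \<open>0 < d\<close> \<open>c \<noteq> 0\<close> by (simp add: distr_fun_scale)
  next
    case False
    then have "\<not> 0 < inverse d * s" using \<open>0 < d\<close> by (simp add: zero_less_mult_iff)
    with False show ?thesis by simp
  qed
  have [measurable]: "?f \<in> borel_measurable borel" using meas by measurable
  have "(\<integral>\<^sup>+s. ?f s \<partial>lborel) = ennreal \<bar>inverse d\<bar> * (\<integral>\<^sup>+s. ?f (0 + inverse d * s) \<partial>lborel)"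
    using \<open>0 < d\<close> by (intro nn_integral_real_affine) auto
  also have "\<dots> = ennreal (inverse d) * (\<integral>\<^sup>+s. ?g s \<partial>lborel)"
    using \<open>0 < d\<close> by (simp only: g) simp
  finally have "ennreal d * (\<integral>\<^sup>+s. ?f s \<partial>lborel) = ennreal (d * inverse d) * (\<integral>\<^sup>+s. ?g s \<partial>lborel)"
    using \<open>0 < d\<close> by (simp add: ennreal_mult mult.assoc del: right_inverse left_inverse)
  then show ?thesis using \<open>0 < d\<close> by (simp add: lorentz_modular_def d_def)
qed

context concave_weight
begin

text \<open>
  Outside \<open>[0,1]\<close> the function \<open>\<psi>\<close> is arbitrary; clamping the argument makes it monotone on the whole
  line, hence Borel.
\<close>

lemma weight_clamp_measurable [measurable]:
  "(\<lambda>t. \<psi> (max 0 (min 1 t))) \<in> borel_measurable borel"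
  by (rule borel_measurable_mono) (auto simp: mono_def intro!: weight_mono)

lemma weight_distr_measurable:
  assumes x: "x \<in> borel_measurable (lebesgue_on {0..1})" and "0 < q"
  shows "(\<lambda>s. ennreal (\<psi> (distr_fun x (s powr (1 / q))))) \<in> borel_measurable borel"
proof -
  have [measurable]: "(\<lambda>\<tau>. - distr_fun x \<tau>) \<in> borel_measurable borel"
    by (rule borel_measurable_mono) (auto simp: mono_def intro!: distr_fun_antimono[OF x])
  have "(\<lambda>s. ennreal (\<psi> (max 0 (min 1 (- (- distr_fun x (s powr (1 / q)))))))) \<in> borel_measurable borel"
    by measurable
  then show ?thesis by (simp add: distr_fun_nonneg distr_fun_le_1 min_absorb2 max_absorb2)
qed

lemma enn2real_lorentz_norm:
  assumes "0 < q" "x \<in> borel_measurable (lebesgue_on {0..1})"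
  shows "enn2real (lorentz_norm q \<psi> x) = enn2real (lorentz_modular q \<psi> x) powr (1 / q)"
  unfolding lorentz_norm_eq_modular[OF assms] by (simp add: ennreal_powr_def)

lemma lorentz_space_iff_modular:
  assumes "0 < q"
  shows "x \<in> lorentz_space q \<psi> \<longleftrightarrow>
    x \<in> borel_measurable (lebesgue_on {0..1}) \<and> lorentz_modular q \<psi> x < \<infinity>"
proof -
  have "ennreal_powr u (1 / q) < \<infinity> \<longleftrightarrow> u < \<infinity>" for u
    by (cases u) (auto simp: ennreal_powr_def)
  then show ?thesis using lorentz_norm_eq_modular[OF assms] by (auto simp: lorentz_space_def)
qed

text \<open>
  By homogeneity it suffices to test normalised coefficient vectors, and a common factor \<open>c\<close> in
  the modular can be scaled away. Two-sided bounds with \<open>1 + \<epsilon>\<close> for the modular give the same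
  bounds for the norm, because taking the root of order \<open>q \<ge> 1\<close> moves ratios towards \<open>1\<close>.
\<close>

lemma symm_finitely_representedI:
  assumes q: "1 \<le> q" and p: "1 \<le> p"
    and ex: "\<And>n \<epsilon>. 1 \<le> n \<Longrightarrow> 0 < \<epsilon> \<Longrightarrow> \<exists>(x :: nat \<Rightarrow> real \<Rightarrow> real) c. 0 < c \<and>
        (\<forall>k<n. x k \<in> borel_measurable (lebesgue_on {0..1})) \<and>
        (\<forall>i<n. \<forall>j<n. equimeasurable (x i) (x j)) \<and>
        disjoint_family_on (\<lambda>k. {t \<in> {0..1}. x k t \<noteq> 0}) {..<n} \<and>
        (\<forall>a. lp_norm p n a = 1 \<longrightarrow>
          ennreal (c / (1 + \<epsilon>)) \<le> lorentz_modular q \<psi> (\<lambda>t. \<Sum>k<n. a k * x k t) \<and>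
          lorentz_modular q \<psi> (\<lambda>t. \<Sum>k<n. a k * x k t) \<le> ennreal ((1 + \<epsilon>) * c))"
  shows "symm_finitely_represented p (lorentz_space q \<psi>) (\<lambda>x. enn2real (lorentz_norm q \<psi> x))"
  unfolding symm_finitely_represented_def
proof (intro allI impI)
  fix n :: nat and \<epsilon> :: real assume n: "1 \<le> n" and "0 < \<epsilon>"
  have "0 < q" using q by simp
  from ex[OF n \<open>0 < \<epsilon>\<close>] obtain x :: "nat \<Rightarrow> real \<Rightarrow> real" and c where c: "0 < c"
    and x: "\<forall>k<n. x k \<in> borel_measurable (lebesgue_on {0..1})"
    and equi: "\<forall>i<n. \<forall>j<n. equimeasurable (x i) (x j)"
    and disj: "disjoint_family_on (\<lambda>k. {t \<in> {0..1}. x k t \<noteq> 0}) {..<n}"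
    and bounds: "\<forall>a. lp_norm p n a = 1 \<longrightarrow>
      ennreal (c / (1 + \<epsilon>)) \<le> lorentz_modular q \<psi> (\<lambda>t. \<Sum>k<n. a k * x k t) \<and>
      lorentz_modular q \<psi> (\<lambda>t. \<Sum>k<n. a k * x k t) \<le> ennreal ((1 + \<epsilon>) * c)"
    by (elim exE conjE) (rule that)
  note x = x[rule_format] and equi = equi[rule_format]
    and bounds = bounds[rule_format, THEN conjunct1] bounds[rule_format, THEN conjunct2]
  \<comment> \<open>Multiplying all functions by b divides the modular by c.\<close>
  define b where "b = c powr (- 1 / q)"
  have "b powr q = c powr (- 1 / q * q)" by (simp only: b_def powr_powr)
  also have "\<dots> = 1 / c" using c \<open>0 < q\<close> by (simp add: powr_minus_divide)
  finally have b: "0 < b" "b powr q = 1 / c" using c by (simp_all add: b_def)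
  have fin: "lorentz_modular q \<psi> (\<lambda>t. \<Sum>k<n. a k * x k t) < \<infinity>" if "lp_norm p n a = 1" for a
    using le_less_trans[OF bounds(2)[OF that] ennreal_less_top] by simp
  have scale: "lorentz_modular q \<psi> (\<lambda>t. d * (\<Sum>k<n. a k * x k t)) =
      ennreal (\<bar>d\<bar> powr q) * lorentz_modular q \<psi> (\<lambda>t. \<Sum>k<n. a k * x k t)" if "d \<noteq> 0" for d a
    using \<open>0 < q\<close> that x
    by (intro lorentz_modular_scale weight_distr_measurable combination_measurable) auto
  show "\<exists>x :: nat \<Rightarrow> real \<Rightarrow> real.
    (\<forall>k<n. x k \<in> lorentz_space q \<psi>) \<and>
    (\<forall>i<n. \<forall>j<n. equimeasurable (x i) (x j)) \<and>
    disjoint_family_on (\<lambda>k. {t \<in> {0..1}. x k t \<noteq> 0}) {..<n} \<and>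
    (\<forall>a. lp_norm p n a / (1 + \<epsilon>) \<le> enn2real (lorentz_norm q \<psi> (\<lambda>t. \<Sum>k<n. a k * x k t)) \<and>
      enn2real (lorentz_norm q \<psi> (\<lambda>t. \<Sum>k<n. a k * x k t)) \<le> (1 + \<epsilon>) * lp_norm p n a)"
  proof (intro exI[of _ "\<lambda>k t. b * x k t"] conjI allI impI)
    fix k assume "k < n"
    let ?u = "\<lambda>j. if j = k then 1 else 0 :: real"
    have "(\<Sum>j<n. ?u j * x j t) = (\<Sum>j<n. if j = k then x j t else 0)" for t
      by (intro sum.cong) auto
    then have "(\<Sum>j<n. ?u j * x j t) = x k t" for t using \<open>k < n\<close> by simp
    with scale[of b ?u] fin[OF lp_norm_unit[OF p \<open>k < n\<close>]] b
    have "lorentz_modular q \<psi> (\<lambda>t. b * x k t) < \<infinity>" by (simp add: ennreal_mult_less_top)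
    then show "(\<lambda>t. b * x k t) \<in> lorentz_space q \<psi>"
      using x[OF \<open>k < n\<close>] \<open>0 < q\<close> by (simp add: lorentz_space_iff_modular)
  next
    fix i j assume "i < n" "j < n"
    then have "equimeasurable (x i) (x j)" by (rule equi)
    then show "equimeasurable (\<lambda>t. b * x i t) (\<lambda>t. b * x j t)"
      using b by (simp add: equimeasurable_def distr_fun_scale)
  next
    show "disjoint_family_on (\<lambda>k. {t \<in> {0..1}. b * x k t \<noteq> 0}) {..<n}"
      using disj b by simp
  next
    fix a
    have "lp_norm p n a / (1 + \<epsilon>) \<le> enn2real (lorentz_norm q \<psi> (\<lambda>t. \<Sum>k<n. a k * (b * x k t))) \<and>
        enn2real (lorentz_norm q \<psi> (\<lambda>t. \<Sum>k<n. a k * (b * x k t))) \<le> (1 + \<epsilon>) * lp_norm p n a"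
    proof (cases "lp_norm p n a = 0")
      case True
      then have "(\<Sum>k<n. a k * (b * x k t)) = 0" for t using lp_norm_zeroD[OF p True] by simp
      moreover have "lorentz_modular q \<psi> (\<lambda>t. 0) = 0"
        by (simp add: lorentz_modular_def distr_fun_zero)
      ultimately show ?thesis using True \<open>0 < q\<close> by (simp add: enn2real_lorentz_norm)
    next
      case False
      define \<sigma> where "\<sigma> = lp_norm p n a"
      have "0 < \<sigma>" using False lp_norm_nonneg[OF n, of p a] by (simp add: \<sigma>_def)
      define y where "y = (\<lambda>t. \<Sum>k<n. a k / \<sigma> * x k t)"
      have one: "lp_norm p n (\<lambda>k. a k / \<sigma>) = 1"
        using lp_norm_divide[OF p n \<open>0 < \<sigma>\<close>, of a] \<open>0 < \<sigma>\<close> by (simp add: \<sigma>_def)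
      have eq: "(\<Sum>k<n. a k * (b * x k t)) = (\<sigma> * b) * y t" for t
        using \<open>0 < \<sigma>\<close> by (simp add: y_def sum_distrib_left field_simps)
      define J where "J = enn2real (lorentz_modular q \<psi> y)"
      have J: "lorentz_modular q \<psi> y = ennreal J" "0 \<le> J"
        using fin[OF one] by (simp_all add: J_def y_def less_top)
      have lo: "c / (1 + \<epsilon>) \<le> J" and hi: "J \<le> (1 + \<epsilon>) * c"
        using bounds(1)[OF one, folded y_def] bounds(2)[OF one, folded y_def] c \<open>0 < \<epsilon>\<close> \<open>0 \<le> J\<close>
        unfolding J(1) by (simp_all add: ennreal_le_iff del: ennreal_mult)
      have "enn2real (lorentz_norm q \<psi> (\<lambda>t. (\<sigma> * b) * y t)) = (\<bar>\<sigma> * b\<bar> powr q * J) powr (1 / q)"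
      proof -
        have y: "y \<in> borel_measurable (lebesgue_on {0..1})"
          unfolding y_def using x by (rule combination_measurable)
        then have "(\<lambda>t. (\<sigma> * b) * y t) \<in> borel_measurable (lebesgue_on {0..1})" by measurable
        moreover have "lorentz_modular q \<psi> (\<lambda>t. (\<sigma> * b) * y t) = ennreal (\<bar>\<sigma> * b\<bar> powr q) * ennreal J"
          using scale[of "\<sigma> * b" "\<lambda>k. a k / \<sigma>"] J(1) b \<open>0 < \<sigma>\<close> unfolding y_def by simp
        ultimately show ?thesis
          using \<open>0 < q\<close> J by (simp add: enn2real_lorentz_norm flip: ennreal_mult)
      qed
      also have "\<dots> = \<sigma> * (J / c) powr (1 / q)"
      proof -
        have "\<bar>\<sigma> * b\<bar> powr q * J = \<sigma> powr q * (J / c)"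
          using \<open>0 < \<sigma>\<close> b by (simp add: powr_mult)
        then have "(\<bar>\<sigma> * b\<bar> powr q * J) powr (1 / q) = (\<sigma> powr q * (J / c)) powr (1 / q)" by simp
        also have "\<dots> = (\<sigma> powr q) powr (1 / q) * (J / c) powr (1 / q)"
          by (rule powr_mult)
        finally show ?thesis using \<open>0 < \<sigma>\<close> \<open>0 < q\<close> by (simp add: powr_powr)
      qed
      finally have N: "enn2real (lorentz_norm q \<psi> (\<lambda>t. \<Sum>k<n. a k * (b * x k t))) = \<sigma> * (J / c) powr (1 / q)"
        unfolding eq .
      have "(J / c) powr (1 / q) \<le> (1 + \<epsilon>) powr (1 / q)"
        using hi J c q \<open>0 < \<epsilon>\<close> by (intro powr_mono2) (auto simp: field_simps)
      also have "\<dots> \<le> (1 + \<epsilon>) powr 1" using q \<open>0 < \<epsilon>\<close> by (intro powr_mono) auto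
      finally have up: "(J / c) powr (1 / q) \<le> 1 + \<epsilon>" using \<open>0 < \<epsilon>\<close> by simp
      have "inverse (1 + \<epsilon>) = (1 / (1 + \<epsilon>)) powr 1" using \<open>0 < \<epsilon>\<close> by (simp add: inverse_eq_divide)
      also have "\<dots> \<le> (1 / (1 + \<epsilon>)) powr (1 / q)"
        using q \<open>0 < \<epsilon>\<close> by (intro powr_mono') (auto simp: field_simps)
      also have "\<dots> \<le> (J / c) powr (1 / q)"
        using lo J c q \<open>0 < \<epsilon>\<close> by (intro powr_mono2) (auto simp: field_simps)
      finally have "\<sigma> * inverse (1 + \<epsilon>) \<le> \<sigma> * (J / c) powr (1 / q)"
        using \<open>0 < \<sigma>\<close> by (intro mult_left_mono) auto
      moreover have "\<sigma> * (J / c) powr (1 / q) \<le> \<sigma> * (1 + \<epsilon>)"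
        using up \<open>0 < \<sigma>\<close> by (intro mult_left_mono) auto
      ultimately show ?thesis unfolding N by (simp add: \<sigma>_def divide_inverse mult.commute)
    qed
    then show "lp_norm p n a / (1 + \<epsilon>) \<le> enn2real (lorentz_norm q \<psi> (\<lambda>t. \<Sum>k<n. a k * (b * x k t)))"
      and "enn2real (lorentz_norm q \<psi> (\<lambda>t. \<Sum>k<n. a k * (b * x k t))) \<le> (1 + \<epsilon>) * lp_norm p n a"
      by blast+
  qed
qed

end

section \<open>The indices bound the representable exponents\<close>

lemma dyadic_bracket:
  assumes "0 < s" "s \<le> (1::real)"
  obtains j where "(1 / 2) ^ Suc j < s" "s \<le> (1 / 2) ^ j"
proof -
  define j where "j = (LEAST j. (1 / 2) ^ Suc j < s)"
  obtain k where "(1 / 2) ^ k < s" using real_arch_pow_inv[of s "1 / 2"] \<open>0 < s\<close> by auto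
  moreover have "(1 / 2 :: real) ^ Suc k \<le> (1 / 2) ^ k" by simp
  ultimately have "(1 / 2) ^ Suc k < s" by linarith
  then have j: "(1 / 2) ^ Suc j < s" unfolding j_def by (rule LeastI)
  have "s \<le> (1 / 2) ^ j"
  proof (cases j)
    case (Suc i)
    then have "\<not> (1 / 2) ^ Suc i < s" unfolding j_def by (intro not_less_Least) simp
    with Suc show ?thesis by simp
  qed (use assms in simp)
  with j show ?thesis by (rule that)
qed

context concave_weight
begin

text \<open>
  The suprema in the indices run over dyadic points only. Rounding \<open>t\<close> to a dyadic point costs the
  factor \<open>2\<close>, which disappears in the limit defining the index.
\<close>

lemma weight_dilation_le:
  assumes R: "0 \<le> R" "\<And>j. dyadic j \<le> R * dyadic (j + m)" and "0 \<le> t" "2 ^ m * t \<le> 1"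
  shows "\<psi> (2 ^ m * t) \<le> 2 * R * \<psi> t"
proof (cases "t = 0")
  case False
  with assms have "0 < 2 ^ m * t" by simp
  then obtain j where j: "(1 / 2) ^ Suc j < 2 ^ m * t" "2 ^ m * t \<le> (1 / 2) ^ j"
    using dyadic_bracket assms(4) by blast
  have "t \<le> 2 ^ m * t" using \<open>0 \<le> t\<close> by (simp add: mult_le_cancel_right1)
  then have "t \<le> 1" using assms(4) by linarith
  have "\<psi> (2 ^ m * t) \<le> dyadic j"
    unfolding dyadic_def using j \<open>0 < 2 ^ m * t\<close> by (intro weight_mono) (auto simp: power_le_one)
  also have "\<dots> \<le> R * dyadic (j + m)" by (rule R)
  also have "\<dots> \<le> R * (2 * dyadic (Suc (j + m)))" by (intro mult_left_mono R dyadic_Suc)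
  also have "\<dots> \<le> R * (2 * \<psi> t)"
  proof -
    have "(1 / 2) ^ Suc (j + m) \<le> t"
      using j(1) by (simp add: power_add field_simps)
    then have "dyadic (Suc (j + m)) \<le> \<psi> t"
      unfolding dyadic_def using \<open>t \<le> 1\<close> by (intro weight_mono) auto
    then show ?thesis using R by (intro mult_left_mono) auto
  qed
  finally show ?thesis by simp
qed simp

lemma weight_le_dilation:
  assumes R: "0 \<le> R" "\<And>j. dyadic (j + m) \<le> R * dyadic j" and "0 \<le> t" "2 ^ m * t \<le> 1"
  shows "\<psi> t \<le> 2 * R * \<psi> (2 ^ m * t)"
proof (cases "t = 0")
  case False
  with assms have "0 < 2 ^ m * t" by simp
  then obtain j where j: "(1 / 2) ^ Suc j < 2 ^ m * t" "2 ^ m * t \<le> (1 / 2) ^ j"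
    using dyadic_bracket assms(4) by blast
  have "t \<le> (1 / 2) ^ (j + m)"
    using j(2) by (simp add: power_add field_simps)
  then have "\<psi> t \<le> dyadic (j + m)"
    unfolding dyadic_def using \<open>0 \<le> t\<close> by (intro weight_mono) (auto simp: power_le_one)
  also have "\<dots> \<le> R * dyadic j" by (rule R)
  also have "\<dots> \<le> R * (2 * dyadic (Suc j))" by (intro mult_left_mono R dyadic_Suc)
  also have "\<dots> \<le> R * (2 * \<psi> (2 ^ m * t))"
  proof -
    have "dyadic (Suc j) \<le> \<psi> (2 ^ m * t)"
      unfolding dyadic_def using j assms(4) by (intro weight_mono) auto
    then show ?thesis using R by (intro mult_left_mono) auto
  qed
  finally show ?thesis by simp
qed simp

lemma lorentz_modular_mono_factor:
  assumes "0 \<le> R" "\<And>s. 0 < s \<Longrightarrow> \<psi> (distr_fun y (s powr (1 / q))) \<le> R * \<psi> (distr_fun x (s powr (1 / q)))"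
    and x: "x \<in> borel_measurable (lebesgue_on {0..1})" and "0 < q"
  shows "lorentz_modular q \<psi> y \<le> ennreal R * lorentz_modular q \<psi> x"
proof -
  have [measurable]: "(\<lambda>s. ennreal (\<psi> (distr_fun x (s powr (1 / q))))) \<in> borel_measurable borel"
    by (rule weight_distr_measurable) fact+
  have "lorentz_modular q \<psi> y \<le> (\<integral>\<^sup>+s. ennreal R * (ennreal (\<psi> (distr_fun x (s powr (1 / q)))) * indicator {0<..} s) \<partial>lborel)"
    unfolding lorentz_modular_def
    using assms by (intro nn_integral_mono) (auto simp: indicator_def ennreal_leI simp flip: ennreal_mult')
  also have "\<dots> = ennreal R * lorentz_modular q \<psi> x"
    unfolding lorentz_modular_def by (intro nn_integral_cmult) measurable
  finally show ?thesis .
qed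

text \<open>
  The factor \<open>2 powr (1/q)\<close> that arises is replaced by \<open>2\<close>.
\<close>

lemma norm_le_of_modular_le:
  assumes q: "1 \<le> q" and "x \<in> borel_measurable (lebesgue_on {0..1})" "y \<in> borel_measurable (lebesgue_on {0..1})"
    and "0 < S" and le: "lorentz_modular q \<psi> y \<le> ennreal (2 * S powr q) * lorentz_modular q \<psi> x"
    and fin: "lorentz_modular q \<psi> x < \<infinity>"
  shows "enn2real (lorentz_norm q \<psi> y) \<le> 2 * S * enn2real (lorentz_norm q \<psi> x)"
proof -
  let ?X = "enn2real (lorentz_modular q \<psi> x)" and ?Y = "enn2real (lorentz_modular q \<psi> y)"
  have "?Y \<le> enn2real (ennreal (2 * S powr q) * lorentz_modular q \<psi> x)"
    using le fin by (intro enn2real_mono) (auto simp: ennreal_mult_less_top)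
  also have "\<dots> = 2 * S powr q * ?X" by (simp add: enn2real_mult)
  finally have "?Y powr (1 / q) \<le> (2 * S powr q * ?X) powr (1 / q)"
    using q by (intro powr_mono2) auto
  also have "\<dots> = 2 powr (1 / q) * S * ?X powr (1 / q)"
    using q \<open>0 < S\<close> by (simp add: powr_mult powr_powr)
  also have "\<dots> \<le> 2 * S * ?X powr (1 / q)"
    using powr_mono[of "1 / q" 1 "2::real"] q \<open>0 < S\<close> by (intro mult_right_mono) auto
  finally show ?thesis using assms by (simp add: enn2real_lorentz_norm)
qed

text \<open>
  Take \<open>n = 2 ^ m\<close> functions and \<open>\<epsilon> = 1\<close>. Their sum \<open>y\<close> has norm about \<open>2 powr (m/p)\<close> and a single
  one has norm about \<open>1\<close>, up to factors \<open>2\<close>. The distribution functions differ by the factor \<open>2 ^ m\<close>,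
  so the dyadic ratios of \<open>\<psi>\<close> at distance \<open>m\<close> bound the quotient of the norms from both sides.
\<close>

lemma represented_dilation_bounds:
  assumes q: "1 \<le> q" and p: "1 \<le> p"
    and rep: "symm_finitely_represented p (lorentz_space q \<psi>) (\<lambda>x. enn2real (lorentz_norm q \<psi> x))"
  shows "2 powr (recip p * real m) / 8 \<le> sup_ratio (\<lambda>j. inverse (dyadic j powr (1 / q))) m"
    and "2 powr (- recip p * real m) / 8 \<le> sup_ratio (\<lambda>j. dyadic j powr (1 / q)) m"
proof -
  let ?n = "2 ^ m :: nat" and ?N = "\<lambda>x. enn2real (lorentz_norm q \<psi> x)"
  have "0 < q" "1 \<le> ?n" using q by auto
  from rep[unfolded symm_finitely_represented_def, rule_format, OF \<open>1 \<le> ?n\<close> zero_less_one]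
  obtain x :: "nat \<Rightarrow> real \<Rightarrow> real"
    where space: "\<forall>k<?n. x k \<in> lorentz_space q \<psi>"
    and equi: "\<forall>i<?n. \<forall>j<?n. equimeasurable (x i) (x j)"
    and disj: "disjoint_family_on (\<lambda>k. {t \<in> {0..1}. x k t \<noteq> 0}) {..<?n}"
    and bounds: "\<forall>a. lp_norm p ?n a / (1 + 1) \<le> ?N (\<lambda>t. \<Sum>k<?n. a k * x k t) \<and>
        ?N (\<lambda>t. \<Sum>k<?n. a k * x k t) \<le> (1 + 1) * lp_norm p ?n a"
    by (elim exE conjE) (rule that)
  have x: "x k \<in> borel_measurable (lebesgue_on {0..1})" if "k < ?n" for k
    using space that \<open>0 < q\<close> by (simp add: lorentz_space_iff_modular)
  have x0: "x 0 \<in> borel_measurable (lebesgue_on {0..1})" by (rule x) simp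
  define y where "y = (\<lambda>t. \<Sum>k<?n. 1 * x k t)"
  have y: "y \<in> borel_measurable (lebesgue_on {0..1})"
    unfolding y_def using x by (rule combination_measurable)
  have dy: "distr_fun y \<tau> = 2 ^ m * distr_fun (x 0) \<tau>" if "0 < \<tau>" for \<tau>
  proof -
    have "distr_fun y \<tau> = (\<Sum>k<?n. distr_fun (x k) \<tau>)"
      using distr_fun_combination[OF x disj, of \<tau> "\<lambda>k. 1"] that by (simp add: y_def)
    also have "\<dots> = (\<Sum>k<?n. distr_fun (x 0) \<tau>)"
    proof (rule sum.cong)
      fix k assume "k \<in> {..<?n}"
      then have "equimeasurable (x k) (x 0)" using equi[rule_format, of k 0] by simp
      then show "distr_fun (x k) \<tau> = distr_fun (x 0) \<tau>" using that by (simp add: equimeasurable_def)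
    qed simp
    finally show ?thesis by simp
  qed
  have Ny: "2 powr (recip p * real m) / 2 \<le> ?N y" "?N y \<le> 2 * 2 powr (recip p * real m)"
  proof -
    have "lp_norm p ?n (\<lambda>k. 1) = 2 powr (recip p * real m)"
      using lp_norm_ones[OF p \<open>1 \<le> ?n\<close>] by (simp add: powr_powr mult.commute flip: powr_realpow)
    then show "2 powr (recip p * real m) / 2 \<le> ?N y" "?N y \<le> 2 * 2 powr (recip p * real m)"
      using bounds[rule_format, of "\<lambda>k. 1"] by (auto simp: y_def)
  qed
  have Nx: "1 / 2 \<le> ?N (x 0)" "?N (x 0) \<le> 2"
  proof -
    let ?u = "\<lambda>k. if k = 0 then 1 else 0 :: real"
    have "(\<Sum>k<?n. ?u k * x k t) = (\<Sum>k<?n. if k = 0 then x k t else 0)" for t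
      by (intro sum.cong) auto
    then have "(\<lambda>t. \<Sum>k<?n. ?u k * x k t) = x 0" by simp
    then show "1 / 2 \<le> ?N (x 0)" "?N (x 0) \<le> 2"
      using bounds[rule_format, of ?u] lp_norm_unit[OF p, of 0 ?n] by auto
  qed
  have xfin: "lorentz_modular q \<psi> (x 0) < \<infinity>"
    using space \<open>0 < q\<close> by (simp add: lorentz_space_iff_modular)
  \<comment> \<open>The supports fit disjointly into [0,1], so all arguments of the weight stay in its domain.\<close>
  have small: "2 ^ m * distr_fun (x 0) \<tau> \<le> 1" if "0 < \<tau>" for \<tau>
    using dy[OF that] distr_fun_le_1[of y \<tau>] by simp
  have pow: "(u powr (1 / q)) powr q = u" if "0 < u" for u using that q by (simp add: powr_powr)
  let ?v = "\<lambda>j. dyadic j powr (1 / q)"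
  have v: "doubling ?v" using q by (intro doubling_dyadic_powr) auto
  note w = doubling_inverse[OF v]
  define S where "S = sup_ratio (\<lambda>j. inverse (?v j)) m"
  define S' where "S' = sup_ratio ?v m"
  have "0 < S" "0 < S'" unfolding S_def S'_def by (rule sup_ratio_pos[OF w], rule sup_ratio_pos[OF v])
  have S: "dyadic j \<le> S powr q * dyadic (j + m)" for j
  proof -
    have "?v j \<le> S * ?v (j + m)"
      using le_sup_ratio[OF w, of j m] dyadic_pos[of j] dyadic_pos[of "j + m"]
      by (simp add: S_def field_simps)
    then have "?v j powr q \<le> (S * ?v (j + m)) powr q"
      using q by (intro powr_mono2) auto
    then show ?thesis using \<open>0 < S\<close> by (simp add: powr_mult pow dyadic_pos)
  qed
  have S': "dyadic (j + m) \<le> S' powr q * dyadic j" for j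
  proof -
    have "?v (j + m) \<le> S' * ?v j" using le_sup_ratio[OF v, of j m] by (simp add: S'_def)
    then have "?v (j + m) powr q \<le> (S' * ?v j) powr q"
      using q by (intro powr_mono2) auto
    then show ?thesis using \<open>0 < S'\<close> by (simp add: powr_mult pow dyadic_pos)
  qed
  have le1: "lorentz_modular q \<psi> y \<le> ennreal (2 * S powr q) * lorentz_modular q \<psi> (x 0)"
    using weight_dilation_le[OF _ S] small x0 \<open>0 < q\<close>
    by (intro lorentz_modular_mono_factor) (auto simp: dy distr_fun_nonneg)
  then have "?N y \<le> 2 * S * ?N (x 0)"
    by (intro norm_le_of_modular_le q x0 y xfin \<open>0 < S\<close>)
  also have "\<dots> \<le> 2 * S * 2" using Nx \<open>0 < S\<close> by (intro mult_left_mono) auto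
  finally show "2 powr (recip p * real m) / 8 \<le> sup_ratio (\<lambda>j. inverse (?v j)) m"
    using Ny by (simp add: S_def)
  have yfin: "lorentz_modular q \<psi> y < \<infinity>"
    using le_less_trans[OF le1] xfin by (simp add: ennreal_mult_less_top)
  have "lorentz_modular q \<psi> (x 0) \<le> ennreal (2 * S' powr q) * lorentz_modular q \<psi> y"
    using weight_le_dilation[OF _ S'] small y \<open>0 < q\<close>
    by (intro lorentz_modular_mono_factor) (auto simp: dy distr_fun_nonneg)
  then have "?N (x 0) \<le> 2 * S' * ?N y"
    by (intro norm_le_of_modular_le q x0 y yfin \<open>0 < S'\<close>)
  also have "\<dots> \<le> 2 * S' * (2 * 2 powr (recip p * real m))" using Ny \<open>0 < S'\<close> by (intro mult_left_mono) auto
  finally have "1 / 2 \<le> 4 * S' * 2 powr (recip p * real m)" using Nx by simp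
  then show "2 powr (- recip p * real m) / 8 \<le> sup_ratio ?v m"
    by (simp add: S'_def powr_minus field_simps)
qed

theorem represented_imp_between_indices:
  assumes q: "1 \<le> q" and p: "1 \<le> p"
    and rep: "symm_finitely_represented p (lorentz_space q \<psi>) (\<lambda>x. enn2real (lorentz_norm q \<psi> x))"
  shows "alpha_index q \<psi> \<le> recip p" "recip p \<le> beta_index q \<psi>"
proof -
  have v: "doubling (\<lambda>j. dyadic j powr (1 / q))" using q by (intro doubling_dyadic_powr) auto
  have "- recip p \<le> growth_exponent (\<lambda>j. dyadic j powr (1 / q))"
    by (rule growth_exponent_geI[OF v, of "1 / 8"])
      (use represented_dilation_bounds(2)[OF assms] in auto)
  then show "alpha_index q \<psi> \<le> recip p" by (simp add: alpha_index_eq[OF q])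
  show "recip p \<le> beta_index q \<psi>"
    unfolding beta_index_eq[OF q]
    by (rule growth_exponent_geI[OF doubling_inverse[OF v], of "1 / 8"])
      (use represented_dilation_bounds(1)[OF assms] in auto)
qed

end

section \<open>Disjoint translates\<close>

lemma translate_measurable:
  fixes g :: "real \<Rightarrow> real"
  assumes [measurable]: "g \<in> borel_measurable borel"
  shows "(\<lambda>t. g (t - b)) \<in> borel_measurable (lebesgue_on {0..1})"
proof -
  have "(\<lambda>t. g (t - b)) \<in> borel_measurable lborel" by measurable
  then show ?thesis by (intro measurable_restrict_space1 measurable_completion)
qed

lemma translates_disjoint:
  fixes g :: "real \<Rightarrow> real"
  assumes supp: "\<And>u. g u \<noteq> 0 \<Longrightarrow> 0 < u \<and> u < T" and "0 < T"
  shows "disjoint_family_on (\<lambda>k. {t \<in> {0..1}. g (t - real k * T) \<noteq> 0}) {..<n}"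
  unfolding disjoint_family_on_def
proof (intro ballI impI)
  fix k l :: nat assume "k \<noteq> l"
  have False if "g (t - real k * T) \<noteq> 0" "g (t - real l * T) \<noteq> 0" for t
  proof -
    from supp[OF that(1)] supp[OF that(2)]
    have "real k * T < t" "t < (real k + 1) * T" "real l * T < t" "t < (real l + 1) * T"
      by (auto simp: algebra_simps)
    then have "real k * T < (real l + 1) * T" "real l * T < (real k + 1) * T" by auto
    then have "real k < real l + 1" "real l < real k + 1" using \<open>0 < T\<close> by auto
    with \<open>k \<noteq> l\<close> show False by simp
  qed
  then show "{t \<in> {0..1}. g (t - real k * T) \<noteq> 0} \<inter> {t \<in> {0..1}. g (t - real l * T) \<noteq> 0} = {}"
    by blast
qed

lemma distr_fun_translate:
  fixes g :: "real \<Rightarrow> real"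
  assumes [measurable]: "g \<in> borel_measurable borel"
    and supp: "\<And>u. g u \<noteq> 0 \<Longrightarrow> 0 < u \<and> u < T" and "0 < T" "real n * T \<le> 1" "k < n" "0 \<le> \<tau>"
  shows "distr_fun (\<lambda>t. g (t - real k * T)) \<tau> = measure lebesgue {u. \<tau> < \<bar>g u\<bar>}"
proof -
  let ?S = "{u. \<tau> < \<bar>g u\<bar>}"
  have "(real k + 1) * T \<le> real n * T" using \<open>k < n\<close> \<open>0 < T\<close> by (intro mult_right_mono) auto
  then have le: "real k * T + T \<le> 1" using \<open>real n * T \<le> 1\<close> by (simp add: algebra_simps)
  have supp': "0 < u \<and> u < T" if "u \<in> ?S" for u using supp[of u] that \<open>0 \<le> \<tau>\<close> by auto
  have img: "(\<lambda>u. real k * T + u) ` ?S = {s. \<tau> < \<bar>g (s - real k * T)\<bar>}"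
    by (auto intro!: image_eqI[of _ _ "s - real k * T" for s])
  have eq: "{s \<in> {0..1}. \<bar>g (s - real k * T)\<bar> > \<tau>} = (\<lambda>u. real k * T + u) ` ?S"
    unfolding img
  proof (intro equalityI subsetI)
    fix s assume s: "s \<in> {s. \<tau> < \<bar>g (s - real k * T)\<bar>}"
    then have "0 < s - real k * T \<and> s - real k * T < T" by (intro supp') simp
    moreover have "0 \<le> real k * T" using \<open>0 < T\<close> by simp
    ultimately have "0 \<le> s" "s \<le> 1" using le by linarith+
    with s show "s \<in> {s \<in> {0..1}. \<bar>g (s - real k * T)\<bar> > \<tau>}" by simp
  qed simp
  have "{s \<in> {0..1}. \<bar>g (s - real k * T)\<bar> > \<tau>} \<subseteq> {0..1}" by blast
  then have "distr_fun (\<lambda>t. g (t - real k * T)) \<tau> = measure lebesgue {s \<in> {0..1}. \<bar>g (s - real k * T)\<bar> > \<tau>}"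
    unfolding distr_fun_def by (intro measure_restrict_space) auto
  also have "\<dots> = measure lebesgue ((\<lambda>u. real k * T + u) ` ?S)" by (simp only: eq)
  finally have "distr_fun (\<lambda>t. g (t - real k * T)) \<tau> = measure lebesgue ((\<lambda>u. real k * T + u) ` ?S)" .
  then show ?thesis by (simp add: measure_translation)
qed

lemma measure_lebesgue_Ioo: "a \<le> b \<Longrightarrow> measure lebesgue {a<..<b::real} = b - a"
  by (simp add: measure_def)

section \<open>The exponent infinity\<close>

context concave_weight
begin

text \<open>
  If every step of length \<open>m\<close> lost a factor \<open>1 + \<epsilon>\<close>, then \<open>\<psi>\<close> would decay like a power and \<open>\<alpha>\<close> would be
  positive.
\<close>

lemma flat_scale_exists:
  assumes q: "1 \<le> q" and "alpha_index q \<psi> \<le> 0" "0 < \<epsilon>" "0 < m"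
  shows "\<exists>j. dyadic j \<le> (1 + \<epsilon>) * dyadic (j + m)"
proof (rule ccontr)
  assume "\<not> ?thesis"
  then have step: "(1 + \<epsilon>) * dyadic (j + m) \<le> dyadic j" for j by (meson less_imp_le not_le)
  have iter: "(1 + \<epsilon>) ^ b * dyadic (j + m * b) \<le> dyadic j" for j b
  proof (induction b)
    case (Suc b)
    have "(1 + \<epsilon>) ^ b * ((1 + \<epsilon>) * dyadic (j + m * b + m)) \<le> (1 + \<epsilon>) ^ b * dyadic (j + m * b)"
      using \<open>0 < \<epsilon>\<close> by (intro mult_left_mono step) auto
    with Suc show ?case by (simp add: add_ac mult_ac)
  qed simp
  let ?\<sigma> = "log 2 (1 + \<epsilon>) / (q * real m)"
  have "0 < ?\<sigma>" using assms by simp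
  have v: "doubling (\<lambda>j. dyadic j powr (1 / q))" using q by (intro doubling_dyadic_powr) auto
  have "growth_exponent (\<lambda>j. dyadic j powr (1 / q)) \<le> - ?\<sigma>"
  proof (rule growth_exponent_leI[OF v, of m 1])
    fix j b
    have "((1 + \<epsilon>) ^ b * dyadic (j + m * b)) powr (1 / q) \<le> dyadic j powr (1 / q)"
      using iter dyadic_pos[of "j + m * b"] q \<open>0 < \<epsilon>\<close> by (intro powr_mono2) auto
    then have *: "((1 + \<epsilon>) ^ b) powr (1 / q) * dyadic (j + m * b) powr (1 / q) \<le> dyadic j powr (1 / q)"
      by (simp add: powr_mult)
    have "((1 + \<epsilon>) ^ b) powr (1 / q) = 2 powr (?\<sigma> * real (m * b))"
    proof -
      have "(1 + \<epsilon>) ^ b = (2 powr log 2 (1 + \<epsilon>)) powr real b"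
        using \<open>0 < \<epsilon>\<close> by (simp add: powr_realpow)
      then have "((1 + \<epsilon>) ^ b) powr (1 / q) = 2 powr (log 2 (1 + \<epsilon>) * real b * (1 / q))"
        by (simp only: powr_powr)
      also have "log 2 (1 + \<epsilon>) * real b * (1 / q) = ?\<sigma> * real (m * b)" using \<open>0 < m\<close> by simp
      finally show ?thesis .
    qed
    with * have "2 powr (?\<sigma> * real (m * b)) * dyadic (j + m * b) powr (1 / q) \<le> dyadic j powr (1 / q)"
      by simp
    then have "dyadic (j + m * b) powr (1 / q) \<le> dyadic j powr (1 / q) / 2 powr (?\<sigma> * real (m * b))"
      by (simp add: pos_le_divide_eq mult.commute)
    also have "\<dots> = 1 * 2 powr (- ?\<sigma> * real (m * b)) * dyadic j powr (1 / q)"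
      by (simp add: powr_minus_divide)
    finally show "dyadic (j + m * b) powr (1 / q) \<le> 1 * 2 powr (- ?\<sigma> * real (m * b)) * dyadic j powr (1 / q)" .
  qed (use \<open>0 < m\<close> in auto)
  with \<open>0 < ?\<sigma>\<close> \<open>alpha_index q \<psi> \<le> 0\<close> show False by (simp add: alpha_index_eq[OF q])
qed

text \<open>
  Let \<open>\<psi> (n T) \<le> (1 + \<epsilon>) * \<psi> T\<close> and take indicator functions of \<open>n\<close> disjoint intervals of length \<open>T\<close>. If
  the largest coefficient is \<open>1\<close>, then below level \<open>1\<close> the distribution function lies between \<open>T\<close>
  and \<open>n T\<close>, and above it vanishes.
\<close>

theorem linf_represented:
  assumes q: "1 \<le> q" and "alpha_index q \<psi> \<le> 0"
  shows "symm_finitely_represented \<infinity> (lorentz_space q \<psi>) (\<lambda>x. enn2real (lorentz_norm q \<psi> x))"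
proof (rule symm_finitely_representedI[OF q])
  fix n :: nat and \<epsilon> :: real assume n: "1 \<le> n" and "0 < \<epsilon>"
  have "0 < q" using q by simp
  have "real n \<le> 2 ^ n" by (metis less_imp_le of_nat_less_two_power)
  obtain j where j: "dyadic j \<le> (1 + \<epsilon>) * dyadic (j + n)"
    using flat_scale_exists[OF assms \<open>0 < \<epsilon>\<close>, of n] n by auto
  define T :: real where "T = (1 / 2) ^ (j + n)"
  define g :: "real \<Rightarrow> real" where "g = indicator {0<..<T}"
  have T: "0 < T" by (simp add: T_def)
  have "real n * T \<le> 2 ^ n * T" using \<open>real n \<le> 2 ^ n\<close> T by (intro mult_right_mono) auto
  also have "\<dots> = (1 / 2) ^ j" by (simp add: T_def power_add power_divide)
  finally have nT: "real n * T \<le> (1 / 2) ^ j" .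
  then have nT1: "real n * T \<le> 1" by (rule order_trans) (simp add: power_le_one)
  have "T \<le> 1" by (simp add: T_def power_le_one)
  have g: "g \<in> borel_measurable borel" "\<And>u. g u \<noteq> 0 \<Longrightarrow> 0 < u \<and> u < T"
    by (auto simp: g_def indicator_def split: if_splits)
  let ?x = "\<lambda>k t. g (t - real k * T)"
  have x: "?x k \<in> borel_measurable (lebesgue_on {0..1})" for k by (intro translate_measurable g)
  have disj: "disjoint_family_on (\<lambda>k. {t \<in> {0..1}. ?x k t \<noteq> 0}) {..<n}"
    by (rule translates_disjoint[OF g(2) T])
  have dist: "distr_fun (?x k) \<tau> = (if \<tau> < 1 then T else 0)" if "k < n" "0 \<le> \<tau>" for k \<tau>
  proof -
    have "{u. \<tau> < \<bar>g u\<bar>} = (if \<tau> < 1 then {0<..<T} else {})"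
      using that by (auto simp: g_def indicator_def)
    then show ?thesis using distr_fun_translate[OF g T nT1 that] T by (simp add: measure_lebesgue_Ioo)
  qed
  have \<psi>T: "0 < \<psi> T" "\<psi> (real n * T) \<le> (1 + \<epsilon>) * \<psi> T"
  proof -
    show "0 < \<psi> T" using T \<open>T \<le> 1\<close> by (rule weight_pos)
    have "\<psi> (real n * T) \<le> dyadic j"
      unfolding dyadic_def using T nT by (intro weight_mono) (auto simp: power_le_one)
    with j show "\<psi> (real n * T) \<le> (1 + \<epsilon>) * \<psi> T" by (simp add: dyadic_def T_def)
  qed
  have "ennreal (\<psi> T / (1 + \<epsilon>)) \<le> lorentz_modular q \<psi> (\<lambda>t. \<Sum>k<n. a k * ?x k t) \<and>
      lorentz_modular q \<psi> (\<lambda>t. \<Sum>k<n. a k * ?x k t) \<le> ennreal ((1 + \<epsilon>) * \<psi> T)"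
    if a: "lp_norm \<infinity> n a = 1" for a
  proof -
    let ?d = "distr_fun (\<lambda>t. \<Sum>k<n. a k * ?x k t)"
    have d: "?d \<tau> = (\<Sum>k<n. if \<tau> < \<bar>a k\<bar> then T else 0)" if "0 \<le> \<tau>" for \<tau>
    proof -
      have "?d \<tau> = (\<Sum>k<n. if a k = 0 then 0 else distr_fun (?x k) (\<tau> / \<bar>a k\<bar>))"
        using x disj that by (rule distr_fun_combination)
      also have "\<dots> = (\<Sum>k<n. if \<tau> < \<bar>a k\<bar> then T else 0)"
        using that by (intro sum.cong) (auto simp: dist)
      finally show ?thesis .
    qed
    have max: "Max ((\<lambda>k. \<bar>a k\<bar>) ` {..<n}) = 1" using a by (simp add: lp_norm_def)
    have le1: "\<bar>a k\<bar> \<le> 1" if "k < n" for k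
      using Max_ge[of "(\<lambda>k. \<bar>a k\<bar>) ` {..<n}" "\<bar>a k\<bar>"] that max by simp
    have "1 \<in> (\<lambda>k. \<bar>a k\<bar>) ` {..<n}"
      using Max_in[of "(\<lambda>k. \<bar>a k\<bar>) ` {..<n}"] max n by (auto simp: lessThan_empty_iff)
    then obtain m where m: "m < n" "\<bar>a m\<bar> = 1" by force
    have root: "s powr (1 / q) < 1 \<longleftrightarrow> s < 1" if "0 < s" for s
      using powr_less_mono2[of "1 / q" s 1] powr_mono2[of "1 / q" 1 s] that q by (cases "s < 1") auto
    have bounds: "ennreal (\<psi> T) * indicator {0<..<1} s \<le> ennreal (\<psi> (?d (s powr (1 / q)))) * indicator {0<..} s"
      "ennreal (\<psi> (?d (s powr (1 / q)))) * indicator {0<..} s \<le> ennreal ((1 + \<epsilon>) * \<psi> T) * indicator {0<..<1} s" for s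
    proof -
      have "T \<le> ?d (s powr (1 / q))" "?d (s powr (1 / q)) \<le> real n * T" if "0 < s" "s < 1"
      proof -
        have "(if s powr (1 / q) < \<bar>a m\<bar> then T else 0) \<le> (\<Sum>k<n. if s powr (1 / q) < \<bar>a k\<bar> then T else 0)"
          using m T by (intro member_le_sum) auto
        then show "T \<le> ?d (s powr (1 / q))" using m root[of s] that by (simp add: d)
        have "(\<Sum>k<n. if s powr (1 / q) < \<bar>a k\<bar> then T else 0) \<le> (\<Sum>k<n. T)"
          using T by (intro sum_mono) auto
        then show "?d (s powr (1 / q)) \<le> real n * T" by (simp add: d)
      qed
      then have in01: "\<psi> T \<le> \<psi> (?d (s powr (1 / q)))" "\<psi> (?d (s powr (1 / q))) \<le> (1 + \<epsilon>) * \<psi> T"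
        if "0 < s" "s < 1"
        using that T nT1 \<psi>T(2) weight_mono[of T "?d (s powr (1 / q))"]
          weight_mono[of "?d (s powr (1 / q))" "real n * T"] distr_fun_le_1 distr_fun_nonneg
        by fastforce+
      have out: "?d (s powr (1 / q)) = 0" if "1 \<le> s"
      proof -
        have "1 \<le> s powr (1 / q)" using root[of s] that by simp
        then have "\<not> s powr (1 / q) < \<bar>a k\<bar>" if "k < n" for k using le1[OF that] by simp
        then show ?thesis by (simp add: d)
      qed
      show "ennreal (\<psi> T) * indicator {0<..<1} s \<le> ennreal (\<psi> (?d (s powr (1 / q)))) * indicator {0<..} s"
        using in01 by (auto simp: indicator_def intro!: ennreal_leI)
      show "ennreal (\<psi> (?d (s powr (1 / q)))) * indicator {0<..} s \<le> ennreal ((1 + \<epsilon>) * \<psi> T) * indicator {0<..<1} s"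
        using in01 out by (cases "s < 1") (auto simp: indicator_def intro!: ennreal_leI)
    qed
    have "ennreal (\<psi> T / (1 + \<epsilon>)) \<le> ennreal (\<psi> T)"
      using \<psi>T \<open>0 < \<epsilon>\<close> by (intro ennreal_leI) (simp add: field_simps)
    also have "\<dots> = (\<integral>\<^sup>+s. ennreal (\<psi> T) * indicator {0<..<1::real} s \<partial>lborel)"
      by (simp add: nn_integral_cmult_indicator)
    also have "\<dots> \<le> lorentz_modular q \<psi> (\<lambda>t. \<Sum>k<n. a k * ?x k t)"
      unfolding lorentz_modular_def by (rule nn_integral_mono) (rule bounds)
    finally have lower: "ennreal (\<psi> T / (1 + \<epsilon>)) \<le> lorentz_modular q \<psi> (\<lambda>t. \<Sum>k<n. a k * ?x k t)" .
    have "lorentz_modular q \<psi> (\<lambda>t. \<Sum>k<n. a k * ?x k t) \<le>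
        (\<integral>\<^sup>+s. ennreal ((1 + \<epsilon>) * \<psi> T) * indicator {0<..<1::real} s \<partial>lborel)"
      unfolding lorentz_modular_def by (rule nn_integral_mono) (rule bounds)
    also have "\<dots> = ennreal ((1 + \<epsilon>) * \<psi> T)" by (simp add: nn_integral_cmult_indicator)
    finally show ?thesis using lower by blast
  qed
  moreover have "equimeasurable (?x i) (?x k)" if "i < n" "k < n" for i k
    using that by (simp add: equimeasurable_def dist)
  ultimately show "\<exists>(x :: nat \<Rightarrow> real \<Rightarrow> real) c. 0 < c \<and>
        (\<forall>k<n. x k \<in> borel_measurable (lebesgue_on {0..1})) \<and>
        (\<forall>i<n. \<forall>j<n. equimeasurable (x i) (x j)) \<and>
        disjoint_family_on (\<lambda>k. {t \<in> {0..1}. x k t \<noteq> 0}) {..<n} \<and>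
        (\<forall>a. lp_norm \<infinity> n a = 1 \<longrightarrow>
          ennreal (c / (1 + \<epsilon>)) \<le> lorentz_modular q \<psi> (\<lambda>t. \<Sum>k<n. a k * x k t) \<and>
          lorentz_modular q \<psi> (\<lambda>t. \<Sum>k<n. a k * x k t) \<le> ennreal ((1 + \<epsilon>) * c))"
    using x disj \<psi>T(1) by (intro exI[of _ ?x] exI[of _ "\<psi> T"]) simp
qed simp

end

section \<open>Truncated powers and their combinations\<close>

text \<open>
  The function \<open>u powr (-1/p)\<close> on \<open>(0, 2 powr -i)\<close>, cut off at the height that it attains at
  \<open>u = 2 powr -j\<close>.
\<close>

definition truncated_power :: "real \<Rightarrow> nat \<Rightarrow> nat \<Rightarrow> real \<Rightarrow> real" where
  "truncated_power p i j u =
    (if 0 < u \<and> u < (1 / 2) ^ i then min (2 powr (real j / p)) (u powr (- 1 / p)) else 0)"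

definition truncated_power_distr :: "real \<Rightarrow> nat \<Rightarrow> nat \<Rightarrow> real \<Rightarrow> real" where
  "truncated_power_distr p i j \<tau> =
    (if 2 powr (real j / p) \<le> \<tau> then 0 else min ((1 / 2) ^ i) (\<tau> powr - p))"

lemma truncated_power_measurable [measurable]: "truncated_power p i j \<in> borel_measurable borel"
  unfolding truncated_power_def by measurable

lemma truncated_power_support: "truncated_power p i j u \<noteq> 0 \<Longrightarrow> 0 < u \<and> u < (1 / 2) ^ i"
  by (simp add: truncated_power_def split: if_splits)

lemma less_powr_iff:
  fixes u \<tau> p :: real
  assumes "0 < p" "0 < u" "0 < \<tau>"
  shows "\<tau> < u powr (- 1 / p) \<longleftrightarrow> u < \<tau> powr - p"
proof -
  have "\<tau> < u powr (- 1 / p) \<longleftrightarrow> ln \<tau> < (- 1 / p) * ln u"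
    using assms by (subst ln_less_cancel_iff[symmetric]) (auto simp: ln_powr)
  also have "\<dots> \<longleftrightarrow> p * ln \<tau> < - ln u" using assms by (simp add: field_simps)
  also have "\<dots> \<longleftrightarrow> ln u < - p * ln \<tau>" by auto
  also have "\<dots> \<longleftrightarrow> u < \<tau> powr - p"
    using assms by (subst ln_less_cancel_iff[symmetric, of u]) (auto simp: ln_powr)
  finally show ?thesis .
qed

lemma truncated_power_level:
  assumes "0 < p" "0 < \<tau>"
  shows "measure lebesgue {u. \<tau> < \<bar>truncated_power p i j u\<bar>} = truncated_power_distr p i j \<tau>"
proof -
  have "{u. \<tau> < \<bar>truncated_power p i j u\<bar>} =
      (if 2 powr (real j / p) \<le> \<tau> then {} else {0<..<min ((1 / 2) ^ i) (\<tau> powr - p)})"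
    using assms less_powr_iff[of p _ \<tau>] by (auto simp: truncated_power_def split: if_splits)
  then show ?thesis by (simp add: truncated_power_distr_def measure_lebesgue_Ioo)
qed

lemma truncated_power_distr_nonneg: "0 \<le> truncated_power_distr p i j \<tau>"
  by (simp add: truncated_power_distr_def)

lemma truncated_power_distr_le: "truncated_power_distr p i j \<tau> \<le> (1 / 2) ^ i"
  "truncated_power_distr p i j \<tau> \<le> \<tau> powr - p"
  by (auto simp: truncated_power_distr_def)

lemma power_half_eq_powr: "(1 / 2 :: real) ^ j = 2 powr - real j"
  by (simp add: powr_minus powr_realpow power_divide inverse_eq_divide)

text \<open>
  A normalised coefficient vector for \<open>n\<close> translates of the truncated power that fit side by side
  into \<open>[0,1]\<close>. The exponent \<open>\<theta>\<close> belongs to the variable \<open>s = \<tau> powr q\<close> of the layer-cake integral: there the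
  power \<open>\<tau> powr -p\<close> becomes \<open>s powr (-1/\<theta>)\<close>.
\<close>

locale truncated_power_combination = concave_weight +
  fixes p q \<theta> :: real and n i j :: nat and a :: "nat \<Rightarrow> real"
  assumes p: "0 < p" and q: "1 \<le> q" and theta: "\<theta> = q / p"
    and room: "real n * (1 / 2) ^ i \<le> 1"
    and normalized: "(\<Sum>k<n. \<bar>a k\<bar> powr p) = 1"
begin

definition comb_distr :: "real \<Rightarrow> real" where
  "comb_distr \<tau> = (\<Sum>k<n. if a k = 0 then 0 else truncated_power_distr p i j (\<tau> / \<bar>a k\<bar>))"

lemma theta_pos: "0 < \<theta>" using p q by (simp add: theta)

lemma coeff_le_1: "k < n \<Longrightarrow> \<bar>a k\<bar> \<le> 1"
proof (rule ccontr)
  assume "k < n" "\<not> \<bar>a k\<bar> \<le> 1"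
  then have "1 powr p < \<bar>a k\<bar> powr p" using p by (intro powr_less_mono2) auto
  moreover have "\<bar>a k\<bar> powr p \<le> (\<Sum>k<n. \<bar>a k\<bar> powr p)"
    using \<open>k < n\<close> by (intro member_le_sum) auto
  ultimately show False using normalized by simp
qed

lemma comb_distr_nonneg: "0 \<le> comb_distr \<tau>"
  unfolding comb_distr_def by (intro sum_nonneg) (simp add: truncated_power_distr_nonneg)

lemma comb_distr_eq_0:
  assumes "2 powr (real j / p) \<le> \<tau>"
  shows "comb_distr \<tau> = 0"
  unfolding comb_distr_def
proof (rule sum.neutral, intro ballI)
  fix k assume "k \<in> {..<n}"
  have "0 < \<tau>" using assms by (rule less_le_trans[rotated]) simp
  have "\<tau> \<le> \<tau> / \<bar>a k\<bar>" if "a k \<noteq> 0"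
    using that coeff_le_1[of k] \<open>k \<in> {..<n}\<close> \<open>0 < \<tau>\<close> by (simp add: pos_le_divide_eq mult_le_cancel_left2)
  then show "(if a k = 0 then 0 else truncated_power_distr p i j (\<tau> / \<bar>a k\<bar>)) = 0"
    using assms by (auto simp: truncated_power_distr_def)
qed

lemma comb_distr_le_plateau: "comb_distr \<tau> \<le> real n * (1 / 2) ^ i"
proof -
  have "comb_distr \<tau> \<le> (\<Sum>k<n. (1 / 2) ^ i)"
    unfolding comb_distr_def by (intro sum_mono) (simp add: truncated_power_distr_le)
  then show ?thesis by simp
qed

lemma powr_quotient:
  assumes "0 < \<tau>" "c \<noteq> 0"
  shows "(\<tau> / \<bar>c\<bar>) powr - p = \<bar>c\<bar> powr p * \<tau> powr - p"
  by (simp add: powr_divide powr_minus_divide)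

text \<open>
  Each truncated distribution function lies below the pure power, for which the combination
  reproduces the power exactly by the normalisation.
\<close>

lemma comb_distr_le_power:
  assumes "0 < \<tau>"
  shows "comb_distr \<tau> \<le> \<tau> powr - p"
proof -
  have "comb_distr \<tau> \<le> (\<Sum>k<n. \<bar>a k\<bar> powr p * \<tau> powr - p)"
    unfolding comb_distr_def
  proof (intro sum_mono)
    fix k
    show "(if a k = 0 then 0 else truncated_power_distr p i j (\<tau> / \<bar>a k\<bar>)) \<le> \<bar>a k\<bar> powr p * \<tau> powr - p"
      using truncated_power_distr_le(2)[of p i j "\<tau> / \<bar>a k\<bar>"] powr_quotient[OF assms, of "a k"] by auto
  qed
  also have "\<dots> = \<tau> powr - p" by (simp add: normalized flip: sum_distrib_right)
  finally show ?thesis .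
qed

text \<open>
  For a coefficient with \<open>\<bar>a k\<bar> powr p > h\<close>, the levels \<open>\<tau>\<close> considered here are mapped by \<open>\<tau> / \<bar>a k\<bar>\<close> into the
  range where the distribution function is the pure power. The remaining coefficients are dropped; they
  carry at most the part \<open>n * h\<close> of the sum \<open>1\<close>.
\<close>

lemma comb_distr_ge_power:
  assumes "0 < h" "2 powr (real i / p) \<le> \<tau>" "\<tau> < h powr (1 / p) * 2 powr (real j / p)"
  shows "(1 - real n * h) * \<tau> powr - p \<le> comb_distr \<tau>"
proof -
  have "0 < \<tau>" using assms(2) by (rule less_le_trans[rotated]) simp
  have "(\<Sum>k<n. (\<bar>a k\<bar> powr p - h) * \<tau> powr - p) \<le> comb_distr \<tau>"
    unfolding comb_distr_def
  proof (intro sum_mono)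
    fix k assume "k \<in> {..<n}"
    show "(\<bar>a k\<bar> powr p - h) * \<tau> powr - p \<le> (if a k = 0 then 0 else truncated_power_distr p i j (\<tau> / \<bar>a k\<bar>))"
    proof (cases "\<bar>a k\<bar> powr p \<le> h")
      case True
      then have "(\<bar>a k\<bar> powr p - h) * \<tau> powr - p \<le> 0" by (simp add: mult_le_0_iff)
      with truncated_power_distr_nonneg[of p i j "\<tau> / \<bar>a k\<bar>"] show ?thesis by auto
    next
      case False
      then have "a k \<noteq> 0" using \<open>0 < h\<close> by auto
      have "h powr (1 / p) < (\<bar>a k\<bar> powr p) powr (1 / p)"
        using False \<open>0 < h\<close> p by (intro powr_less_mono2) auto
      then have "h powr (1 / p) < \<bar>a k\<bar>" using p by (simp add: powr_powr)
      then have "h powr (1 / p) * 2 powr (real j / p) \<le> \<bar>a k\<bar> * 2 powr (real j / p)"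
        by (intro mult_right_mono) auto
      with assms(3) have "\<tau> < \<bar>a k\<bar> * 2 powr (real j / p)" by (rule less_le_trans)
      then have "\<tau> / \<bar>a k\<bar> < 2 powr (real j / p)"
        using \<open>a k \<noteq> 0\<close> by (simp add: pos_divide_less_eq mult.commute)
      have "\<tau> \<le> \<tau> / \<bar>a k\<bar>"
        using \<open>a k \<noteq> 0\<close> coeff_le_1[of k] \<open>k \<in> {..<n}\<close> \<open>0 < \<tau>\<close>
        by (simp add: pos_le_divide_eq mult_le_cancel_left2)
      with assms(2) have "2 powr (real i / p) \<le> \<tau> / \<bar>a k\<bar>" by linarith
      then have "(\<tau> / \<bar>a k\<bar>) powr - p \<le> (2 powr (real i / p)) powr - p"
        using p by (intro powr_mono2') auto
      also have "\<dots> = (1 / 2) ^ i" using p by (simp add: powr_powr power_half_eq_powr)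
      finally have "truncated_power_distr p i j (\<tau> / \<bar>a k\<bar>) = (\<tau> / \<bar>a k\<bar>) powr - p"
        using \<open>\<tau> / \<bar>a k\<bar> < 2 powr (real j / p)\<close> by (simp add: truncated_power_distr_def)
      also have "\<dots> = \<bar>a k\<bar> powr p * \<tau> powr - p" by (rule powr_quotient) fact+
      finally show ?thesis using \<open>a k \<noteq> 0\<close> \<open>0 < h\<close> by (simp add: mult_right_mono)
    qed
  qed
  moreover have "(\<Sum>k<n. (\<bar>a k\<bar> powr p - h) * \<tau> powr - p) = (1 - real n * h) * \<tau> powr - p"
    by (simp add: normalized sum_subtractf flip: sum_distrib_right)
  ultimately show ?thesis by simp
qed

end

context concave_weight
begin

text \<open>
  The value of \<open>\<psi>\<close> at the pure power in the layer-cake variable. The clamp keeps the argument in the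
  domain of \<open>\<psi>\<close> and changes nothing for the \<open>s \<ge> 1\<close> that occur.
\<close>

definition power_weight :: "real \<Rightarrow> real \<Rightarrow> real" where
  "power_weight \<theta> s = \<psi> (max 0 (min 1 (s powr (- 1 / \<theta>))))"

lemma power_weight_measurable [measurable]: "power_weight \<theta> \<in> borel_measurable borel"
proof -
  have "(\<lambda>t. \<psi> (max 0 (min 1 t))) \<circ> (\<lambda>s. s powr (- 1 / \<theta>)) \<in> borel_measurable borel"
    by (rule measurable_comp[of _ borel borel]) measurable
  then show ?thesis by (simp add: power_weight_def[abs_def] comp_def)
qed

lemma power_weight_nonneg: "0 \<le> power_weight \<theta> s"
  unfolding power_weight_def by (rule weight_nonneg) auto

lemma scale_powr:
  assumes "0 < \<theta>"
  shows "(2 powr (\<theta> * real l)) powr (- 1 / \<theta>) = (1 / 2) ^ l"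
  using assms by (simp add: powr_powr power_half_eq_powr)

lemma scale_powr_mono:
  assumes "0 < \<theta>" "2 powr (\<theta> * real l) \<le> s"
  shows "s powr (- 1 / \<theta>) \<le> (1 / 2) ^ l"
  unfolding scale_powr[OF \<open>0 < \<theta>\<close>, symmetric]
  using assms by (intro powr_mono2') auto

lemma power_weight_eq:
  assumes "0 < \<theta>" "2 powr (\<theta> * real i) \<le> s"
  shows "power_weight \<theta> s = \<psi> (s powr (- 1 / \<theta>))" "s powr (- 1 / \<theta>) \<le> 1"
proof -
  have "s powr (- 1 / \<theta>) \<le> (1 / 2) ^ i" by (rule scale_powr_mono[OF assms])
  also have "\<dots> \<le> 1" by (simp add: power_le_one)
  finally show "s powr (- 1 / \<theta>) \<le> 1" .
  then show "power_weight \<theta> s = \<psi> (s powr (- 1 / \<theta>))"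
    by (simp add: power_weight_def min_absorb2 max_absorb2)
qed

text \<open>
  The contribution of the window to the modular; the levels \<open>s\<close> between the bounds correspond
  to the arguments of \<open>\<psi>\<close> between \<open>2 powr -j\<close> and \<open>2 powr -i\<close>.
\<close>

definition window_mass :: "real \<Rightarrow> nat \<Rightarrow> nat \<Rightarrow> ennreal" where
  "window_mass \<theta> i j =
    (\<integral>\<^sup>+s. ennreal (power_weight \<theta> s) * indicator {2 powr (\<theta> * real i)..<2 powr (\<theta> * real j)} s \<partial>lborel)"

lemma window_mass_finite: "window_mass \<theta> i j < \<infinity>"
proof -
  have "window_mass \<theta> i j \<le> (\<integral>\<^sup>+s. ennreal (\<psi> 1) * indicator {0..<2 powr (\<theta> * real j)} s \<partial>lborel)"
    unfolding window_mass_def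
  proof (rule nn_integral_mono)
    fix s :: real
    have "(0::real) < 2 powr (\<theta> * real i)" by simp
    moreover have "power_weight \<theta> s \<le> \<psi> 1" unfolding power_weight_def by (rule weight_mono) auto
    ultimately show "ennreal (power_weight \<theta> s) * indicator {2 powr (\<theta> * real i)..<2 powr (\<theta> * real j)} s
        \<le> ennreal (\<psi> 1) * indicator {0..<2 powr (\<theta> * real j)} s"
      by (auto simp: indicator_def intro!: ennreal_leI simp del: powr_gt_zero)
  qed
  also have "\<dots> = ennreal (\<psi> 1) * ennreal (2 powr (\<theta> * real j))"
    by (simp add: nn_integral_cmult_indicator)
  also have "\<dots> < \<infinity>" by (simp add: ennreal_mult_less_top)
  finally show ?thesis .
qed

text \<open>
  Dyadic blocks: on the block of levels ending at \<open>2 powr (\<theta> * l)\<close> the integrand is at least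
  \<open>\<psi> (2 powr -l)\<close>, and the block has length \<open>(1 - 2 powr -\<theta>) * 2 powr (\<theta> * l)\<close>.
\<close>

lemma window_mass_ge_sum:
  assumes "0 < \<theta>" "i \<le> j"
  shows "ennreal ((1 - 2 powr - \<theta>) * (\<Sum>l\<in>{i<..j}. 2 powr (\<theta> * real l) * dyadic l)) \<le> window_mass \<theta> i j"
  using \<open>i \<le> j\<close>
proof (induction j rule: dec_induct)
  case (step j)
  let ?s = "\<lambda>l::nat. 2 powr (\<theta> * real l) :: real"
  have s: "?s i \<le> ?s j" "?s j \<le> ?s (Suc j)"
    using \<open>0 < \<theta>\<close> step by (auto simp: algebra_simps)
  have "0 < 1 - 2 powr - \<theta>"
    using \<open>0 < \<theta>\<close> powr_less_mono[of "- \<theta>" 0 "2::real"] by simp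
  have diff: "?s (Suc j) - ?s j = (1 - 2 powr - \<theta>) * ?s (Suc j)"
    by (simp add: algebra_simps flip: powr_add)
  have "{i<..Suc j} = insert (Suc j) {i<..j}" using step by auto
  then have "(1 - 2 powr - \<theta>) * (\<Sum>l\<in>{i<..Suc j}. ?s l * dyadic l) =
      (1 - 2 powr - \<theta>) * (?s (Suc j) * dyadic (Suc j)) + (1 - 2 powr - \<theta>) * (\<Sum>l\<in>{i<..j}. ?s l * dyadic l)"
    by (simp add: distrib_left del: of_nat_Suc)
  also have "(1 - 2 powr - \<theta>) * (?s (Suc j) * dyadic (Suc j)) = dyadic (Suc j) * (?s (Suc j) - ?s j)"
    by (simp only: diff mult_ac)
  finally have "(1 - 2 powr - \<theta>) * (\<Sum>l\<in>{i<..Suc j}. ?s l * dyadic l) =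
      (1 - 2 powr - \<theta>) * (\<Sum>l\<in>{i<..j}. ?s l * dyadic l) + dyadic (Suc j) * (?s (Suc j) - ?s j)"
    by (simp only: add.commute)
  then have "ennreal ((1 - 2 powr - \<theta>) * (\<Sum>l\<in>{i<..Suc j}. ?s l * dyadic l)) =
      ennreal ((1 - 2 powr - \<theta>) * (\<Sum>l\<in>{i<..j}. ?s l * dyadic l)) + ennreal (dyadic (Suc j) * (?s (Suc j) - ?s j))"
    using \<open>0 < 1 - 2 powr - \<theta>\<close> s dyadic_pos
    by (simp only:) (intro ennreal_plus mult_nonneg_nonneg sum_nonneg, auto intro: less_imp_le)
  also have "\<dots> \<le> window_mass \<theta> i j + (\<integral>\<^sup>+s. ennreal (dyadic (Suc j)) * indicator {?s j..<?s (Suc j)} s \<partial>lborel)"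
    using step.IH s dyadic_pos[of "Suc j"]
    by (intro add_mono) (auto simp: nn_integral_cmult_indicator ennreal_mult)
  also have "\<dots> = (\<integral>\<^sup>+s. ennreal (power_weight \<theta> s) * indicator {?s i..<?s j} s +
      ennreal (dyadic (Suc j)) * indicator {?s j..<?s (Suc j)} s \<partial>lborel)"
    unfolding window_mass_def by (rule nn_integral_add[symmetric]) measurable
  also have "\<dots> \<le> window_mass \<theta> i (Suc j)"
    unfolding window_mass_def
  proof (rule nn_integral_mono)
    fix s
    have "dyadic (Suc j) \<le> power_weight \<theta> s" if "?s j \<le> s" "s < ?s (Suc j)"
    proof -
      have "0 < s" using that(1) by (rule less_le_trans[rotated]) simp
      then have "(1 / 2) ^ Suc j \<le> s powr (- 1 / \<theta>)"
        unfolding scale_powr[OF \<open>0 < \<theta>\<close>, symmetric, of "Suc j"]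
        using that \<open>0 < \<theta>\<close> by (intro powr_mono2') auto
      then show ?thesis
        using power_weight_eq[OF \<open>0 < \<theta>\<close> that(1)] unfolding dyadic_def by (auto intro!: weight_mono)
    qed
    note compare = this
    show "ennreal (power_weight \<theta> s) * indicator {?s i..<?s j} s +
        ennreal (dyadic (Suc j)) * indicator {?s j..<?s (Suc j)} s
        \<le> ennreal (power_weight \<theta> s) * indicator {?s i..<?s (Suc j)} s"
    proof -
      have "ennreal w * indicator {x..<y} s + ennreal d * indicator {y..<z} s \<le> ennreal w * indicator {x..<z} s"
        if "x \<le> y" "y \<le> z" "y \<le> s \<Longrightarrow> s < z \<Longrightarrow> d \<le> w" for x y z w d :: real
        using that by (auto simp: indicator_def intro!: ennreal_leI)
      from this[OF s compare] show ?thesis by blast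
    qed
  qed
  finally show ?case .
qed simp

text \<open>
  The window without the levels at its upper end, at which translates with small coefficients
  (\<open>\<bar>a k\<bar> powr p \<le> h\<close>) may already be cut off.
\<close>

definition window_core_mass :: "real \<Rightarrow> nat \<Rightarrow> nat \<Rightarrow> real \<Rightarrow> ennreal" where
  "window_core_mass \<theta> i j h =
    (\<integral>\<^sup>+s. ennreal (power_weight \<theta> s) *
      indicator {s. 2 powr (\<theta> * real i) \<le> s \<and> s < 2 powr (\<theta> * real j) \<and> s < h powr \<theta> * 2 powr (\<theta> * real j)} s \<partial>lborel)"

lemma window_core_mass_le: "window_core_mass \<theta> i j h \<le> window_mass \<theta> i j"
  unfolding window_core_mass_def window_mass_def
  by (rule nn_integral_mono) (auto simp: indicator_def)

text \<open>
  The omitted levels are shorter than \<open>2 powr (\<theta> * j)\<close> in total. The argument of \<open>\<psi>\<close> there is at most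
  \<open>2 powr -j / h\<close>, so by concavity \<open>\<psi>\<close> is at most \<open>\<psi> (2 powr -j) / h\<close>.
\<close>

lemma window_mass_le_core:
  assumes "0 < \<theta>" "0 < h"
  shows "window_mass \<theta> i j \<le> window_core_mass \<theta> i j h + ennreal (2 powr (\<theta> * real j) * dyadic j / h)"
proof -
  let ?s = "\<lambda>l::nat. 2 powr (\<theta> * real l) :: real"
  have "window_mass \<theta> i j \<le> (\<integral>\<^sup>+s. ennreal (power_weight \<theta> s) *
      indicator {s. ?s i \<le> s \<and> s < ?s j \<and> s < h powr \<theta> * ?s j} s +
      ennreal (dyadic j / h) * indicator {0..<?s j} s \<partial>lborel)"
    unfolding window_mass_def
  proof (rule nn_integral_mono)
    fix s
    have "power_weight \<theta> s \<le> dyadic j / h" if "?s i \<le> s" "s < ?s j" "h powr \<theta> * ?s j \<le> s"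
    proof -
      let ?t = "s powr (- 1 / \<theta>)"
      have "0 < s" using that(1) by (rule less_le_trans[rotated]) simp
      then have lo: "(1 / 2) ^ j \<le> ?t"
        unfolding scale_powr[OF \<open>0 < \<theta>\<close>, symmetric, of j]
        using that \<open>0 < \<theta>\<close> by (intro powr_mono2') auto
      have "?t \<le> (h powr \<theta> * ?s j) powr (- 1 / \<theta>)"
        using that \<open>0 < \<theta>\<close> \<open>0 < h\<close> by (intro powr_mono2') auto
      also have "\<dots> = (h powr \<theta>) powr (- 1 / \<theta>) * (1 / 2) ^ j"
        by (simp only: powr_mult scale_powr[OF \<open>0 < \<theta>\<close>])
      also have "(h powr \<theta>) powr (- 1 / \<theta>) = 1 / h"
        using \<open>0 < \<theta>\<close> \<open>0 < h\<close> by (simp add: powr_powr powr_minus_divide)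
      finally have hi: "?t / (1 / 2) ^ j \<le> 1 / h" using \<open>0 < h\<close> by (simp add: field_simps)
      have "\<psi> ?t \<le> ?t / (1 / 2) ^ j * \<psi> ((1 / 2) ^ j)"
        using lo power_weight_eq(2)[OF \<open>0 < \<theta>\<close> that(1)] by (intro weight_compare) auto
      also have "\<dots> \<le> 1 / h * \<psi> ((1 / 2) ^ j)"
        using hi dyadic_pos[of j] unfolding dyadic_def by (intro mult_right_mono) auto
      finally show ?thesis
        using power_weight_eq(1)[OF \<open>0 < \<theta>\<close> that(1)] by (simp add: dyadic_def)
    qed
    moreover have "0 < ?s i" by simp
    ultimately show "ennreal (power_weight \<theta> s) * indicator {?s i..<?s j} s \<le>
        ennreal (power_weight \<theta> s) * indicator {s. ?s i \<le> s \<and> s < ?s j \<and> s < h powr \<theta> * ?s j} s +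
        ennreal (dyadic j / h) * indicator {0..<?s j} s"
      by (auto simp: indicator_def not_less intro!: ennreal_leI simp del: powr_gt_zero)
  qed
  also have "\<dots> = window_core_mass \<theta> i j h + (\<integral>\<^sup>+s. ennreal (dyadic j / h) * indicator {0..<?s j} s \<partial>lborel)"
    unfolding window_core_mass_def by (rule nn_integral_add) measurable
  also have "(\<integral>\<^sup>+s. ennreal (dyadic j / h) * indicator {0..<?s j} s \<partial>lborel) = ennreal (?s j * dyadic j / h)"
    using dyadic_pos[of j] \<open>0 < h\<close>
    by (simp add: nn_integral_cmult_indicator mult.commute flip: ennreal_mult)
  finally show ?thesis .
qed

end

context truncated_power_combination
begin

abbreviation "combination \<equiv> \<lambda>t. \<Sum>k<n. a k * truncated_power p i j (t - real k * (1 / 2) ^ i)"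

lemma distr_combination:
  assumes "0 < \<tau>"
  shows "distr_fun combination \<tau> = comb_distr \<tau>"
proof -
  let ?T = "(1 / 2 :: real) ^ i"
  have "distr_fun combination \<tau> = (\<Sum>k<n. if a k = 0 then 0 else
      distr_fun (\<lambda>t. truncated_power p i j (t - real k * ?T)) (\<tau> / \<bar>a k\<bar>))"
    using assms truncated_power_support
    by (intro distr_fun_combination translate_measurable translates_disjoint) auto
  also have "\<dots> = comb_distr \<tau>"
    unfolding comb_distr_def
  proof (rule sum.cong)
    fix k assume "k \<in> {..<n}"
    show "(if a k = 0 then 0 else distr_fun (\<lambda>t. truncated_power p i j (t - real k * ?T)) (\<tau> / \<bar>a k\<bar>)) =
      (if a k = 0 then 0 else truncated_power_distr p i j (\<tau> / \<bar>a k\<bar>))"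
    proof (cases "a k = 0")
      case False
      have "distr_fun (\<lambda>t. truncated_power p i j (t - real k * ?T)) (\<tau> / \<bar>a k\<bar>) =
          measure lebesgue {u. \<tau> / \<bar>a k\<bar> < \<bar>truncated_power p i j u\<bar>}"
        using assms \<open>k \<in> {..<n}\<close> room truncated_power_support
        by (intro distr_fun_translate[of _ ?T n]) auto
      also have "\<dots> = truncated_power_distr p i j (\<tau> / \<bar>a k\<bar>)"
        using assms False p by (intro truncated_power_level) auto
      finally show ?thesis using False by simp
    qed simp
  qed simp
  finally show ?thesis .
qed

lemma root_scale: "(2 powr (\<theta> * real l)) powr (1 / q) = 2 powr (real l / p)"
  using p q by (simp add: powr_powr theta)

lemma root_powr: "(s powr (1 / q)) powr - p = s powr (- 1 / \<theta>)"
  using p q by (simp add: powr_powr theta)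

lemma root_ge: "2 powr (\<theta> * real l) \<le> s \<Longrightarrow> 2 powr (real l / p) \<le> s powr (1 / q)"
  unfolding root_scale[symmetric] using q by (intro powr_mono2) auto

text \<open>
  Inside the window the distribution function of the combination is at most the pure power. Below
  the window it is at most \<open>n * 2 powr -i\<close>, at which \<open>\<psi>\<close> is at most \<open>n * \<psi> (2 powr -i)\<close>, and above the
  window it vanishes.
\<close>

lemma modular_upper:
  "lorentz_modular q \<psi> combination \<le>
    ennreal (real n * (2 powr (\<theta> * real i) * dyadic i)) + window_mass \<theta> i j"
proof -
  let ?s = "\<lambda>l::nat. 2 powr (\<theta> * real l) :: real"
  have "n \<noteq> 0" using normalized by (cases n) auto
  have "lorentz_modular q \<psi> combination \<le> (\<integral>\<^sup>+s. ennreal (real n * dyadic i) * indicator {0<..<?s i} s +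
      ennreal (power_weight \<theta> s) * indicator {?s i..<?s j} s \<partial>lborel)"
    unfolding lorentz_modular_def
  proof (rule nn_integral_mono)
    fix s :: real
    let ?\<tau> = "s powr (1 / q)"
    consider "s \<le> 0" | "0 < s" "s < ?s i" | "0 < s" "?s i \<le> s" "s < ?s j" | "0 < s" "?s i \<le> s" "?s j \<le> s"
      by linarith
    then show "ennreal (\<psi> (distr_fun combination ?\<tau>)) * indicator {0<..} s \<le>
        ennreal (real n * dyadic i) * indicator {0<..<?s i} s + ennreal (power_weight \<theta> s) * indicator {?s i..<?s j} s"
    proof cases
      case 1
      then show ?thesis by simp
    next
      case 2
      have "\<psi> (comb_distr ?\<tau>) \<le> \<psi> (real n * (1 / 2) ^ i)"
        by (intro weight_mono comb_distr_nonneg comb_distr_le_plateau room)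
      also have "\<dots> \<le> real n * \<psi> ((1 / 2) ^ i)"
        using \<open>n \<noteq> 0\<close> room by (intro weight_scale_up) auto
      finally have "\<psi> (distr_fun combination ?\<tau>) \<le> real n * dyadic i"
        using 2 by (simp add: distr_combination dyadic_def)
      with 2 show ?thesis by (auto intro!: ennreal_leI)
    next
      case 3
      have "comb_distr ?\<tau> \<le> s powr (- 1 / \<theta>)"
        using comb_distr_le_power[of ?\<tau>] 3 by (simp add: root_powr)
      then have "\<psi> (comb_distr ?\<tau>) \<le> power_weight \<theta> s"
        using power_weight_eq[OF theta_pos 3(2)] by (auto intro: weight_mono comb_distr_nonneg)
      with 3 show ?thesis by (auto simp: distr_combination intro!: ennreal_leI)
    next
      case 4
      then have "comb_distr ?\<tau> = 0" by (intro comb_distr_eq_0 root_ge)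
      with 4 show ?thesis by (simp add: distr_combination)
    qed
  qed
  also have "\<dots> = (\<integral>\<^sup>+s. ennreal (real n * dyadic i) * indicator {0<..<?s i} s \<partial>lborel) + window_mass \<theta> i j"
    unfolding window_mass_def by (rule nn_integral_add) measurable
  also have "(\<integral>\<^sup>+s. ennreal (real n * dyadic i) * indicator {0<..<?s i} s \<partial>lborel) =
      ennreal (real n * (?s i * dyadic i))"
    using dyadic_pos[of i]
    by (simp add: nn_integral_cmult_indicator mult_ac flip: ennreal_mult)
  finally show ?thesis .
qed

text \<open>
  On the core the distribution function is at least \<open>1 - n * h\<close> times the pure power, and concavity
  takes this factor out of \<open>\<psi>\<close>.
\<close>

lemma modular_lower:
  assumes "0 < h" "real n * h \<le> 1"
  shows "ennreal (1 - real n * h) * window_core_mass \<theta> i j h \<le> lorentz_modular q \<psi> combination"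
proof -
  let ?s = "\<lambda>l::nat. 2 powr (\<theta> * real l) :: real"
  let ?C = "{s. ?s i \<le> s \<and> s < ?s j \<and> s < h powr \<theta> * ?s j}"
  have "ennreal (1 - real n * h) * window_core_mass \<theta> i j h =
      (\<integral>\<^sup>+s. ennreal (1 - real n * h) * (ennreal (power_weight \<theta> s) * indicator ?C s) \<partial>lborel)"
    unfolding window_core_mass_def by (rule nn_integral_cmult[symmetric]) measurable
  also have "\<dots> \<le> lorentz_modular q \<psi> combination"
    unfolding lorentz_modular_def
  proof (rule nn_integral_mono)
    fix s :: real
    let ?\<tau> = "s powr (1 / q)"
    show "ennreal (1 - real n * h) * (ennreal (power_weight \<theta> s) * indicator ?C s) \<le>
        ennreal (\<psi> (distr_fun combination ?\<tau>)) * indicator {0<..} s"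
    proof (cases "s \<in> ?C")
      case True
      then have s: "?s i \<le> s" "s < ?s j" "s < h powr \<theta> * ?s j" by auto
      have "0 < s" using s(1) by (rule less_le_trans[rotated]) simp
      have "?\<tau> < (h powr \<theta> * ?s j) powr (1 / q)"
        using s \<open>0 < s\<close> q by (intro powr_less_mono2) auto
      also have "\<dots> = h powr (1 / p) * 2 powr (real j / p)"
        using p q by (simp add: powr_mult root_scale) (simp add: powr_powr theta)
      finally have "(1 - real n * h) * s powr (- 1 / \<theta>) \<le> comb_distr ?\<tau>"
        using comb_distr_ge_power[OF \<open>0 < h\<close> root_ge[OF s(1)]] by (simp add: root_powr)
      then have "\<psi> ((1 - real n * h) * s powr (- 1 / \<theta>)) \<le> \<psi> (comb_distr ?\<tau>)"
        using assms order_trans[OF comb_distr_le_plateau room] by (intro weight_mono) auto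
      moreover have "(1 - real n * h) * \<psi> (s powr (- 1 / \<theta>)) \<le> \<psi> ((1 - real n * h) * s powr (- 1 / \<theta>))"
        using assms power_weight_eq(2)[OF theta_pos s(1)] by (intro weight_scale_down) auto
      ultimately have "(1 - real n * h) * power_weight \<theta> s \<le> \<psi> (distr_fun combination ?\<tau>)"
        using \<open>0 < s\<close> power_weight_eq(1)[OF theta_pos s(1)] by (simp add: distr_combination)
      with True \<open>0 < s\<close> assms show ?thesis
        by (auto simp: power_weight_nonneg intro!: ennreal_leI simp flip: ennreal_mult)
    qed simp
  qed
  finally show ?thesis .
qed

end

section \<open>The theorem\<close>

context concave_weight
begin

text \<open>
  Choose a window whose ends \<open>W i\<close>, \<open>W j\<close> are at most \<open>\<kappa>\<close> times its mass \<open>I\<close>. Then the modular of every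
  normalised combination lies between \<open>(1 - n h) (1 - \<kappa> / h) I\<close> and \<open>(1 + n \<kappa>) I\<close>.
\<close>

theorem lp_represented:
  assumes q: "1 \<le> q" and p: "1 \<le> p"
    and index: "alpha_index q \<psi> \<le> 1 / p" "1 / p \<le> beta_index q \<psi>"
  shows "symm_finitely_represented (ereal p) (lorentz_space q \<psi>) (\<lambda>x. enn2real (lorentz_norm q \<psi> x))"
proof (rule symm_finitely_representedI[OF q])
  fix n :: nat and \<epsilon> :: real assume n: "1 \<le> n" and "0 < \<epsilon>"
  have "0 < p" using p by simp
  define \<theta> where "\<theta> = q / p"
  have "0 < \<theta>" using p q by (simp add: \<theta>_def)
  define e where "e = min \<epsilon> 1"
  have e: "0 < e" "e \<le> \<epsilon>" "e \<le> 1" using \<open>0 < \<epsilon>\<close> by (auto simp: e_def)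
  \<comment> \<open>Both error terms n h and \<kappa> / h of the lower bound become e / 4, and (1 - e / 4)^2 (1 + e) \<ge> 1 for e \<le> 1.\<close>
  define h \<kappa> where "h = e / (4 * real n)" and "\<kappa> = h * (e / 4)"
  have h: "0 < h" "real n * h = e / 4" and \<kappa>: "0 < \<kappa>" "\<kappa> / h = e / 4" "real n * \<kappa> \<le> e"
    using e n by (auto simp: h_def \<kappa>_def field_simps power2_eq_square)
  define c0 where "c0 = 1 - 2 powr - \<theta>"
  have "0 < c0" using \<open>0 < \<theta>\<close> powr_less_mono[of "- \<theta>" 0 "2::real"] by (simp add: c0_def)
  let ?W = "\<lambda>l. 2 powr (\<theta> * real l) * dyadic l"
  have \<theta>_eq: "q * (1 / p) = \<theta>" by (simp add: \<theta>_def)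
  \<comment> \<open>The window starts at i \<ge> n, so that n intervals of length 2^(-i) fit into [0,1].\<close>
  obtain i j where ij: "n \<le> i" "i < j" and window: "?W i + ?W j \<le> (c0 * \<kappa>) * (\<Sum>l\<in>{i<..j}. ?W l)"
    using window_exists[OF q _ index, of "c0 * \<kappa>" n] p \<open>0 < c0\<close> \<kappa> unfolding \<theta>_eq by auto
  have W: "0 < ?W l" for l using dyadic_pos[of l] by simp
  define I where "I = enn2real (window_mass \<theta> i j)"
  have I: "window_mass \<theta> i j = ennreal I"
    using window_mass_finite[of \<theta> i j] by (simp add: I_def less_top)
  have "ennreal (c0 * (\<Sum>l\<in>{i<..j}. ?W l)) \<le> ennreal I"
    using window_mass_ge_sum[OF \<open>0 < \<theta>\<close>, of i j] ij by (simp add: I c0_def)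
  moreover have "0 \<le> I" by (simp add: I_def)
  ultimately have "c0 * (\<Sum>l\<in>{i<..j}. ?W l) \<le> I" by simp
  then have "\<kappa> * (c0 * (\<Sum>l\<in>{i<..j}. ?W l)) \<le> \<kappa> * I" using \<kappa> by (intro mult_left_mono) auto
  with window have edges: "?W i + ?W j \<le> \<kappa> * I" by (simp add: mult_ac)
  then have Wi: "?W i \<le> \<kappa> * I" and Wj: "?W j \<le> \<kappa> * I" using W[of i] W[of j] by linarith+
  have "0 < \<kappa> * I" using Wi W[of i] by linarith
  then have "0 < I" using \<kappa> by (simp add: zero_less_mult_iff)
  have room: "real n * (1 / 2) ^ i \<le> 1"
  proof -
    have "real n \<le> 2 ^ n" by (metis less_imp_le of_nat_less_two_power)
    also have "\<dots> \<le> 2 ^ i" using ij by (intro power_increasing) auto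
    finally have "real n \<le> 2 ^ i" .
    then show ?thesis by (simp add: power_divide)
  qed
  let ?T = "(1 / 2 :: real) ^ i"
  let ?x = "\<lambda>k t. truncated_power p i j (t - real k * ?T)"
  have "?x k \<in> borel_measurable (lebesgue_on {0..1})" for k
    by (intro translate_measurable truncated_power_measurable)
  moreover have "equimeasurable (?x k) (?x l)" if "k < n" "l < n" for k l
    using that room by (simp add: equimeasurable_def distr_fun_translate[OF _ truncated_power_support])
  moreover have "disjoint_family_on (\<lambda>k. {t \<in> {0..1}. ?x k t \<noteq> 0}) {..<n}"
    by (rule translates_disjoint[OF truncated_power_support]) auto
  moreover have "ennreal (I / (1 + \<epsilon>)) \<le> lorentz_modular q \<psi> (\<lambda>t. \<Sum>k<n. a k * ?x k t) \<and>
      lorentz_modular q \<psi> (\<lambda>t. \<Sum>k<n. a k * ?x k t) \<le> ennreal ((1 + \<epsilon>) * I)"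
    if a: "lp_norm (ereal p) n a = 1" for a
  proof -
    let ?S = "\<Sum>k<n. \<bar>a k\<bar> powr p"
    have "?S powr (1 / p) = 1" using a by (simp add: lp_norm_def)
    then have "(?S powr (1 / p)) powr p = 1" by simp
    then have "?S powr 1 = 1" using p by (simp only: powr_powr) simp
    moreover have "0 \<le> ?S" by (intro sum_nonneg) simp
    ultimately have "?S = 1" by simp
    then interpret truncated_power_combination \<psi> p q \<theta> n i j a
      using \<open>0 < p\<close> q room by unfold_locales (auto simp: \<theta>_def)
    have "lorentz_modular q \<psi> combination \<le> ennreal (real n * ?W i + I)"
      using modular_upper W[of i] \<open>0 \<le> I\<close> by (simp add: I ennreal_plus)
    also have "\<dots> \<le> ennreal ((1 + \<epsilon>) * I)"
    proof (rule ennreal_leI)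
      have "real n * ?W i \<le> real n * (\<kappa> * I)" using Wi by (intro mult_left_mono) auto
      also have "\<dots> = real n * \<kappa> * I" by simp
      also have "\<dots> \<le> \<epsilon> * I" using \<kappa> e \<open>0 \<le> I\<close> by (intro mult_right_mono) auto
      finally show "real n * ?W i + I \<le> (1 + \<epsilon>) * I" by (simp add: algebra_simps)
    qed
    finally have up: "lorentz_modular q \<psi> combination \<le> ennreal ((1 + \<epsilon>) * I)" .
    define K where "K = enn2real (window_core_mass \<theta> i j h)"
    have K: "window_core_mass \<theta> i j h = ennreal K" "0 \<le> K"
      using le_less_trans[OF window_core_mass_le window_mass_finite, of \<theta> i j h]
      by (simp_all add: K_def less_top)
    have "ennreal I \<le> ennreal (K + ?W j / h)"
      using window_mass_le_core[OF \<open>0 < \<theta>\<close> h(1), of i j] h W[of j] K(2) by (simp add: I K(1))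
    then have "I \<le> K + ?W j / h" using h W[of j] K(2) by (subst (asm) ennreal_le_iff) auto
    moreover have "?W j / h \<le> \<kappa> * I / h" using Wj h by (intro divide_right_mono) auto
    moreover have "\<kappa> * I / h = e / 4 * I" by (simp add: mult.commute flip: \<kappa>(2))
    ultimately have "I - e / 4 * I \<le> K" by linarith
    then have "(1 - e / 4) * I \<le> K" by (simp add: left_diff_distrib)
    have "1 / (1 + \<epsilon>) \<le> 1 / (1 + e)" using e by (intro divide_left_mono) auto
    also have "\<dots> \<le> (1 - e / 4) * (1 - e / 4)"
    proof -
      have "1 \<le> (1 - e / 2) * (1 + e)"
        using mult_left_mono[of e 1 e] e by (simp add: algebra_simps)
      then have "1 / (1 + e) \<le> 1 - e / 2" using e by (simp add: pos_divide_le_eq)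
      also have "\<dots> \<le> (1 - e / 4) * (1 - e / 4)" by (simp add: algebra_simps)
      finally show ?thesis .
    qed
    finally have "1 / (1 + \<epsilon>) * I \<le> (1 - e / 4) * (1 - e / 4) * I"
      using \<open>0 \<le> I\<close> by (intro mult_right_mono) auto
    also have "\<dots> = (1 - e / 4) * ((1 - e / 4) * I)" by simp
    also have "\<dots> \<le> (1 - e / 4) * K"
      using \<open>(1 - e / 4) * I \<le> K\<close> e by (intro mult_left_mono) auto
    finally have "ennreal (I / (1 + \<epsilon>)) \<le> ennreal (1 - e / 4) * ennreal K"
      using e K(2) by (simp add: ennreal_leI flip: ennreal_mult)
    also have "\<dots> \<le> lorentz_modular q \<psi> combination"
      using modular_lower[OF h(1)] h(2) e by (simp add: K(1))
    finally show ?thesis using up by blast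
  qed
  ultimately show "\<exists>(x :: nat \<Rightarrow> real \<Rightarrow> real) c. 0 < c \<and>
        (\<forall>k<n. x k \<in> borel_measurable (lebesgue_on {0..1})) \<and>
        (\<forall>i<n. \<forall>j<n. equimeasurable (x i) (x j)) \<and>
        disjoint_family_on (\<lambda>k. {t \<in> {0..1}. x k t \<noteq> 0}) {..<n} \<and>
        (\<forall>a. lp_norm (ereal p) n a = 1 \<longrightarrow>
          ennreal (c / (1 + \<epsilon>)) \<le> lorentz_modular q \<psi> (\<lambda>t. \<Sum>k<n. a k * x k t) \<and>
          lorentz_modular q \<psi> (\<lambda>t. \<Sum>k<n. a k * x k t) \<le> ennreal ((1 + \<epsilon>) * c))"
    using \<open>0 < I\<close> by (intro exI[of _ ?x] exI[of _ I]) simp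
qed (use p in simp)

end

theorem theorem9:
  fixes q :: real and \<psi> :: "real \<Rightarrow> real"
  assumes "1 \<le> q"
    and "mono_on {0..1} \<psi>" and "concave_on {0..1} \<psi>"
    and "\<psi> 0 = 0" and "\<exists>t\<in>{0..1}. \<psi> t \<noteq> 0"
  shows "fin_rep_set (lorentz_space q \<psi>) (\<lambda>x. enn2real (lorentz_norm q \<psi> x)) =
         {1 / ereal (beta_index q \<psi>) .. 1 / ereal (alpha_index q \<psi>)}"
proof -
  interpret concave_weight \<psi> using assms by unfold_locales
  note q = \<open>1 \<le> q\<close>
  note nonneg = alpha_index_nonneg[OF q] beta_index_bounds(1)[OF q]
  let ?rep = "\<lambda>p. symm_finitely_represented p (lorentz_space q \<psi>) (\<lambda>x. enn2real (lorentz_norm q \<psi> x))"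
  let ?I = "{1 / ereal (beta_index q \<psi>) .. 1 / ereal (alpha_index q \<psi>)}"
  have ge1: "1 \<le> p" if "p \<in> ?I" for p
  proof -
    have "1 / q \<le> 1" using q by simp
    with beta_index_bounds(2)[OF q] have "beta_index q \<psi> \<le> 1" by (rule order_trans)
    then have "1 \<le> 1 / ereal (beta_index q \<psi>)"
      using nonneg(2) by (cases "beta_index q \<psi> = 0") (auto simp: divide_ereal_def one_ereal_def field_simps)
    with that show ?thesis by auto
  qed
  have "?rep p \<longleftrightarrow> alpha_index q \<psi> \<le> recip p \<and> recip p \<le> beta_index q \<psi>" if p: "1 \<le> p" for p
  proof
    assume "?rep p"
    then show "alpha_index q \<psi> \<le> recip p \<and> recip p \<le> beta_index q \<psi>"
      using represented_imp_between_indices[OF q p] by blast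
  next
    assume *: "alpha_index q \<psi> \<le> recip p \<and> recip p \<le> beta_index q \<psi>"
    show "?rep p"
    proof (cases p)
      case (real r)
      with p * lp_represented[OF q, of r] show ?thesis by (simp add: recip_def)
    next
      case PInf
      with * linf_represented[OF q] show ?thesis by (simp add: recip_def)
    qed (use p in simp)
  qed
  then have "?rep p \<longleftrightarrow> p \<in> ?I" if "1 \<le> p" for p
    using reciprocal_interval_iff[OF that nonneg] that by blast
  then show ?thesis unfolding fin_rep_set_def using ge1 by blast
qed

end
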